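(* Let $\Lambda$ be a finite dimensional algebra over an algebraically closed field $k$ with finite strong global dimension $\eta=\mathrm{s.gl.dim}(\Lambda)\geq 1$. Then $C_{\eta+1}(\mathrm{proj}\Lambda)$ is of tame representation type if and only if $C_n(\mathrm{proj}\Lambda)$ is of tame representation type for all $n\geq 1$.
   Context: $\mathrm{proj}\Lambda$ is the category of finitely generated projective right $\Lambda$-modules. For $n\geq 1$, $C_n(\mathrm{proj}\Lambda)$ is the full subcategory of the category of complexes $X=(X^i,d_X^i)_{i\in\mathbb{Z}}$ over $\mathrm{proj}\Lambda$ (with $d_X^i\colon X^i\to X^{i+1}$) with $X^i=0$ for $i\notin\{1,\dots,n\}$. Strong global dimension: each nonzero $X\in K^b(\mathrm{proj}\Lambda)$ has a representative $\bar X$ in $C^b(\mathrm{proj}\Lambda)$, unique up to isomorphism of complexes, without nonzero contractible direct summands (i.e. without indecomposable projective direct summands in $C^b(\mathrm{proj}\Lambda)$); if $\bar X^r\neq 0\neq\bar X^s$ and $\bar X^i=0$ for $i<r$ and $i>s$, then $\ell(X)=s-r$. $\mathrm{s.gl.dim}(\Lambda)=\sup\{\ell(X)\mid X\in K^b(\mathrm{proj}\Lambda)\text{ indecomposable}\}$. Tame representation type is meant in the usual (Drozd) sense, with finite representation type counted as tame: for each vector $(m_1,\dots,m_n)$ of natural numbers, all but finitely many isomorphism classes of indecomposable complexes $X\in C_n(\mathrm{proj}\Lambda)$ with $\dim_kX^i=m_i$ for all $i$ belong to finitely many one-parameter families, i.e. are of the form $k[x]/(x-\lambda)\otimes_R M$,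 $\lambda\in k$, for $M$ in a finite set of bounded complexes (concentrated in degrees $1,\dots,n$) of finitely generated projective $R$-$\Lambda$-bimodules-type families over localizations $R=k[x]_h$ of $k[x]$, each $M^i$ being of the form $R\otimes_k P^i$ with $P^i\in\mathrm{proj}\Lambda$. *)

theory Defs
  imports
    "HOL-Algebra.Ring"
    "HOL-Algebra.Free_Abelian_Groups"
    "HOL-Computational_Algebra.Fraction_Field"
    "HOL-Computational_Algebra.Polynomial"
    "HOL-Library.Extended_Nat"
begin

text \<open>The class \<^class>\<open>ring_1\<close> excludes only the zero algebra, which has no indecomposable
  complexes and so strong global dimension \<open>0\<close>.\<close>

locale fd_algebra = vector_space scale
  for scale :: "'k::field \<Rightarrow> 'a::ring_1 \<Rightarrow> 'a" +
  assumes scale_mult_left: "scale c x * y = scale c (x * y)"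
    and scale_mult_right: "x * scale c y = scale c (x * y)"
    and finite_dimensional: "\<exists>B. finite B \<and> span B = UNIV"


section \<open>Bimodules\<close>

text \<open>The additive group of a bimodule is an \<^const>\<open>abelian_group\<close> on the \<^typ>\<open>'m ring\<close>
  part of the record; as for the library's module record, the multiplicative part of that record
  carries no meaning. The scalar rings are given by sets \<open>L\<close> and \<open>A\<close>, since the
  localizations of \<open>k[x]\<close> below are subrings of the field of fractions.\<close>

record ('l, 'a, 'm) bimod = "'m ring" +
  lact :: "'l \<Rightarrow> 'm \<Rightarrow> 'm"
  ract :: "'m \<Rightarrow> 'a \<Rightarrow> 'm"

locale bimodule = abelian_group M
  for L :: "'l::ring_1 set" and A :: "'a::ring_1 set" and M :: "('l, 'a, 'm) bimod" +
  assumes lact_closed: "\<lbrakk>l \<in> L; x \<in> carrier M\<rbrakk> \<Longrightarrow> lact M l x \<in> carrier M"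
    and ract_closed: "\<lbrakk>a \<in> A; x \<in> carrier M\<rbrakk> \<Longrightarrow> ract M x a \<in> carrier M"
    and lact_add: "\<lbrakk>l \<in> L; x \<in> carrier M; y \<in> carrier M\<rbrakk> \<Longrightarrow>
      lact M l (x \<oplus>\<^bsub>M\<^esub> y) = lact M l x \<oplus>\<^bsub>M\<^esub> lact M l y"
    and add_lact: "\<lbrakk>l \<in> L; l' \<in> L; x \<in> carrier M\<rbrakk> \<Longrightarrow>
      lact M (l + l') x = lact M l x \<oplus>\<^bsub>M\<^esub> lact M l' x"
    and lact_lact: "\<lbrakk>l \<in> L; l' \<in> L; x \<in> carrier M\<rbrakk> \<Longrightarrow>
      lact M l (lact M l' x) = lact M (l * l') x"
    and lact_one: "x \<in> carrier M \<Longrightarrow> lact M 1 x = x"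
    and add_ract: "\<lbrakk>a \<in> A; x \<in> carrier M; y \<in> carrier M\<rbrakk> \<Longrightarrow>
      ract M (x \<oplus>\<^bsub>M\<^esub> y) a = ract M x a \<oplus>\<^bsub>M\<^esub> ract M y a"
    and ract_add: "\<lbrakk>a \<in> A; a' \<in> A; x \<in> carrier M\<rbrakk> \<Longrightarrow>
      ract M x (a + a') = ract M x a \<oplus>\<^bsub>M\<^esub> ract M x a'"
    and ract_ract: "\<lbrakk>a \<in> A; a' \<in> A; x \<in> carrier M\<rbrakk> \<Longrightarrow>
      ract M (ract M x a) a' = ract M x (a * a')"
    and ract_one: "x \<in> carrier M \<Longrightarrow> ract M x 1 = x"
    and lact_ract: "\<lbrakk>l \<in> L; a \<in> A; x \<in> carrier M\<rbrakk> \<Longrightarrow>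
      lact M l (ract M x a) = ract M (lact M l x) a"

definition bimod_hom ::
  "'l set \<Rightarrow> 'a set \<Rightarrow> ('l, 'a, 'm) bimod \<Rightarrow> ('l, 'a, 'n) bimod \<Rightarrow> ('m \<Rightarrow> 'n) set" where
  "bimod_hom L A M N = {f. f \<in> carrier M \<rightarrow> carrier N \<and>
     (\<forall>x\<in>carrier M. \<forall>y\<in>carrier M. f (x \<oplus>\<^bsub>M\<^esub> y) = f x \<oplus>\<^bsub>N\<^esub> f y) \<and>
     (\<forall>l\<in>L. \<forall>x\<in>carrier M. f (lact M l x) = lact N l (f x)) \<and>
     (\<forall>a\<in>A. \<forall>x\<in>carrier M. f (ract M x a) = ract N (f x) a)}"

definition zero_bimod :: "('l, 'a, 'm) bimod \<Rightarrow> bool" where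
  "zero_bimod M \<longleftrightarrow> carrier M = {\<zero>\<^bsub>M\<^esub>}"


section \<open>Finitely generated projective right modules\<close>

text \<open>A right module over the \<open>k\<close>-algebra given by \<open>scale\<close> is a \<open>k\<close>-\<open>\<Lambda>\<close>-bimodule on
  which \<open>k\<close> acts through \<open>\<Lambda>\<close>.\<close>

definition right_module ::
  "('k::field \<Rightarrow> 'a::ring_1 \<Rightarrow> 'a) \<Rightarrow> ('k, 'a, 'm) bimod \<Rightarrow> bool" where
  "right_module scale M \<longleftrightarrow> bimodule UNIV UNIV M \<and>
     (\<forall>c. \<forall>x\<in>carrier M. lact M c x = ract M x (scale c 1))"

abbreviation mod_hom :: "('k, 'a, 'm) bimod \<Rightarrow> ('k, 'a, 'n) bimod \<Rightarrow> ('m \<Rightarrow> 'n) set" where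
  "mod_hom \<equiv> bimod_hom UNIV UNIV"

definition free_mod ::
  "('k::field \<Rightarrow> 'a::ring_1 \<Rightarrow> 'a) \<Rightarrow> nat \<Rightarrow> ('k, 'a, nat \<Rightarrow> 'a) bimod" where
  "free_mod scale n =
    \<lparr>carrier = {v. \<forall>i\<ge>n. v i = 0}, monoid.mult = undefined, one = undefined,
     ring.zero = (\<lambda>i. 0), ring.add = (\<lambda>v w i. v i + w i),
     lact = (\<lambda>c v i. scale c (v i)), ract = (\<lambda>v a i. v i * a)\<rparr>"

text \<open>Finitely generated projective means: direct summand of some \<open>\<Lambda>\<^sup>n\<close>. The modules are
  those with underlying set in the type \<^typ>\<open>nat \<Rightarrow> 'a\<close>. Since \<open>HOL\<close> does not quantify over
  types, some such bound is needed, and this one is harmless: every finitely generated right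
  module is isomorphic to one of this kind.\<close>

definition proj_mod ::
  "('k::field \<Rightarrow> 'a::ring_1 \<Rightarrow> 'a) \<Rightarrow> ('k, 'a, nat \<Rightarrow> 'a) bimod \<Rightarrow> bool" where
  "proj_mod scale P \<longleftrightarrow> right_module scale P \<and>
     (\<exists>n. \<exists>\<iota> \<in> mod_hom P (free_mod scale n). \<exists>\<pi> \<in> mod_hom (free_mod scale n) P.
        \<forall>x\<in>carrier P. \<pi> (\<iota> x) = x)"

text \<open>\<open>dim\<^sub>k M = d\<close>: there is a family \<open>b\<^sub>0, \<dots>, b\<^sub>d\<^sub>-\<^sub>1\<close> such that every element is a unique
  linear combination of it.\<close>

definition has_dim :: "('k::field, 'a, 'm) bimod \<Rightarrow> nat \<Rightarrow> bool" where
  "has_dim M d \<longleftrightarrow> (\<exists>b \<in> {..<d} \<rightarrow> carrier M.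
     bij_betw (\<lambda>c. finsum M (\<lambda>i. lact M (c i) (b i)) {..<d}) ({..<d} \<rightarrow>\<^sub>E UNIV) (carrier M))"


section \<open>Complexes\<close>

record ('l, 'a, 'm) cpx =
  obj :: "int \<Rightarrow> ('l, 'a, 'm) bimod"
  diff :: "int \<Rightarrow> 'm \<Rightarrow> 'm"

definition complex_over :: "'l set \<Rightarrow> 'a set \<Rightarrow> ('l, 'a, 'm) cpx \<Rightarrow> bool" where
  "complex_over L A X \<longleftrightarrow>
     (\<forall>i. diff X i \<in> bimod_hom L A (obj X i) (obj X (i + 1))) \<and>
     (\<forall>i. \<forall>x\<in>carrier (obj X i). diff X (i + 1) (diff X i x) = \<zero>\<^bsub>obj X (i + 1 + 1)\<^esub>)"

definition zero_cpx :: "('l, 'a, 'm) cpx \<Rightarrow> bool" where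
  "zero_cpx X \<longleftrightarrow> (\<forall>i. zero_bimod (obj X i))"

text \<open>The bounded complexes over \<open>proj \<Lambda>\<close>: the objects of both \<open>C\<^sup>b(proj \<Lambda>)\<close> and
  \<open>K\<^sup>b(proj \<Lambda>)\<close>.\<close>

definition Cb ::
  "('k::field \<Rightarrow> 'a::ring_1 \<Rightarrow> 'a) \<Rightarrow> ('k, 'a, nat \<Rightarrow> 'a) cpx set" where
  "Cb scale = {X. complex_over UNIV UNIV X \<and> (\<forall>i. proj_mod scale (obj X i)) \<and>
     (\<exists>r s. \<forall>i. i < r \<or> s < i \<longrightarrow> zero_bimod (obj X i))}"

definition Cn ::
  "('k::field \<Rightarrow> 'a::ring_1 \<Rightarrow> 'a) \<Rightarrow> nat \<Rightarrow> ('k, 'a, nat \<Rightarrow> 'a) cpx set" where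
  "Cn scale n = {X. complex_over UNIV UNIV X \<and> (\<forall>i. proj_mod scale (obj X i)) \<and>
     (\<forall>i. i \<notin> {1..int n} \<longrightarrow> zero_bimod (obj X i))}"

definition chain_map ::
  "('k, 'a, 'm) cpx \<Rightarrow> ('k, 'a, 'n) cpx \<Rightarrow> (int \<Rightarrow> 'm \<Rightarrow> 'n) set" where
  "chain_map X Y = {f. (\<forall>i. f i \<in> mod_hom (obj X i) (obj Y i)) \<and>
     (\<forall>i. \<forall>x\<in>carrier (obj X i). f (i + 1) (diff X i x) = diff Y i (f i x))}"

definition id_map :: "int \<Rightarrow> 'm \<Rightarrow> 'm" where
  "id_map i = (\<lambda>x. x)"

definition zero_map :: "('k, 'a, 'n) cpx \<Rightarrow> int \<Rightarrow> 'm \<Rightarrow> 'n" where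
  "zero_map Y i = (\<lambda>x. \<zero>\<^bsub>obj Y i\<^esub>)"

definition comp_map :: "(int \<Rightarrow> 'n \<Rightarrow> 'p) \<Rightarrow> (int \<Rightarrow> 'm \<Rightarrow> 'n) \<Rightarrow> int \<Rightarrow> 'm \<Rightarrow> 'p" where
  "comp_map g f i = g i \<circ> f i"

definition add_map ::
  "('k, 'a, 'n) cpx \<Rightarrow> (int \<Rightarrow> 'm \<Rightarrow> 'n) \<Rightarrow> (int \<Rightarrow> 'm \<Rightarrow> 'n) \<Rightarrow> int \<Rightarrow> 'm \<Rightarrow> 'n" where
  "add_map Y f g i = (\<lambda>x. f i x \<oplus>\<^bsub>obj Y i\<^esub> g i x)"

text \<open>Equality of chain maps in the category of complexes (only the values on the carriers
  matter), and in the homotopy category.\<close>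

definition same_map ::
  "('k, 'a, 'm) cpx \<Rightarrow> ('k, 'a, 'n) cpx \<Rightarrow> (int \<Rightarrow> 'm \<Rightarrow> 'n) \<Rightarrow> (int \<Rightarrow> 'm \<Rightarrow> 'n) \<Rightarrow> bool" where
  "same_map X Y f g \<longleftrightarrow> (\<forall>i. \<forall>x\<in>carrier (obj X i). f i x = g i x)"

definition homotopic ::
  "('k, 'a, 'm) cpx \<Rightarrow> ('k, 'a, 'n) cpx \<Rightarrow> (int \<Rightarrow> 'm \<Rightarrow> 'n) \<Rightarrow> (int \<Rightarrow> 'm \<Rightarrow> 'n) \<Rightarrow> bool" where
  "homotopic X Y f g \<longleftrightarrow>
     (\<exists>s. (\<forall>i. s i \<in> mod_hom (obj X i) (obj Y (i - 1))) \<and>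
       (\<forall>i. \<forall>x\<in>carrier (obj X i).
          f i x = g i x \<oplus>\<^bsub>obj Y i\<^esub> (diff Y (i - 1) (s i x) \<oplus>\<^bsub>obj Y i\<^esub> s (i + 1) (diff X i x))))"

definition iso_C :: "('k, 'a, 'm) cpx \<Rightarrow> ('k, 'a, 'n) cpx \<Rightarrow> bool" where
  "iso_C X Y \<longleftrightarrow> (\<exists>f \<in> chain_map X Y. \<exists>g \<in> chain_map Y X.
     same_map X X (comp_map g f) id_map \<and> same_map Y Y (comp_map f g) id_map)"

definition iso_K :: "('k, 'a, 'm) cpx \<Rightarrow> ('k, 'a, 'n) cpx \<Rightarrow> bool" where
  "iso_K X Y \<longleftrightarrow> (\<exists>f \<in> chain_map X Y. \<exists>g \<in> chain_map Y X.
     homotopic X X (comp_map g f) id_map \<and> homotopic Y Y (comp_map f g) id_map)"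

definition contractible_cpx :: "('k, 'a, 'm) cpx \<Rightarrow> bool" where
  "contractible_cpx X \<longleftrightarrow> homotopic X X id_map (zero_map X)"


section \<open>Direct sums and indecomposability\<close>

text \<open>In the following, \<open>E\<close> is the equality of morphisms of the category in question, i.e.
  \<^const>\<open>same_map\<close> or \<^const>\<open>homotopic\<close>. The equations say that \<open>X\<close> is a biproduct of \<open>Y\<close>
  and \<open>Z\<close>, which in an additive category is the meaning of \<open>X \<cong> Y \<oplus> Z\<close>.\<close>

type_synonym ('k, 'a, 'm) map_eq =
  "('k, 'a, 'm) cpx \<Rightarrow> ('k, 'a, 'm) cpx \<Rightarrow> (int \<Rightarrow> 'm \<Rightarrow> 'm) \<Rightarrow> (int \<Rightarrow> 'm \<Rightarrow> 'm) \<Rightarrow> bool"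

definition direct_sum ::
  "('k, 'a, 'm) map_eq \<Rightarrow> ('k, 'a, 'm) cpx \<Rightarrow> ('k, 'a, 'm) cpx \<Rightarrow> ('k, 'a, 'm) cpx \<Rightarrow> bool" where
  "direct_sum E X Y Z \<longleftrightarrow>
     (\<exists>\<iota>Y \<in> chain_map Y X. \<exists>\<pi>Y \<in> chain_map X Y. \<exists>\<iota>Z \<in> chain_map Z X. \<exists>\<pi>Z \<in> chain_map X Z.
        E Y Y (comp_map \<pi>Y \<iota>Y) id_map \<and> E Z Z (comp_map \<pi>Z \<iota>Z) id_map \<and>
        E Z Y (comp_map \<pi>Y \<iota>Z) (zero_map Y) \<and> E Y Z (comp_map \<pi>Z \<iota>Y) (zero_map Z) \<and>
        E X X (add_map X (comp_map \<iota>Y \<pi>Y) (comp_map \<iota>Z \<pi>Z)) id_map)"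

text \<open>An object is zero in the category iff its identity equals its zero endomorphism.\<close>

definition indecomposable ::
  "('k, 'a, 'm) map_eq \<Rightarrow> ('k, 'a, 'm) cpx set \<Rightarrow> ('k, 'a, 'm) cpx \<Rightarrow> bool" where
  "indecomposable E \<C> X \<longleftrightarrow> X \<in> \<C> \<and> \<not> E X X id_map (zero_map X) \<and>
     (\<forall>Y\<in>\<C>. \<forall>Z\<in>\<C>. direct_sum E X Y Z \<longrightarrow>
        E Y Y id_map (zero_map Y) \<or> E Z Z id_map (zero_map Z))"


section \<open>Strong global dimension\<close>

definition no_contractible_summand ::
  "('k::field \<Rightarrow> 'a::ring_1 \<Rightarrow> 'a) \<Rightarrow> ('k, 'a, nat \<Rightarrow> 'a) cpx \<Rightarrow> bool" where
  "no_contractible_summand scale X \<longleftrightarrow>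
     (\<forall>Y\<in>Cb scale. \<forall>Z\<in>Cb scale. direct_sum same_map X Y Z \<and> contractible_cpx Y \<longrightarrow> zero_cpx Y)"

text \<open>\<open>\<ell>(X) = l\<close>, where \<open>Y\<close> is the representative of \<open>X\<close> without nonzero contractible direct
  summands. It is a relation because the uniqueness of \<open>Y\<close> up to isomorphism is a theorem.\<close>

definition has_length ::
  "('k::field \<Rightarrow> 'a::ring_1 \<Rightarrow> 'a) \<Rightarrow> ('k, 'a, nat \<Rightarrow> 'a) cpx \<Rightarrow> nat \<Rightarrow> bool" where
  "has_length scale X l \<longleftrightarrow>
     (\<exists>Y\<in>Cb scale. iso_K X Y \<and> no_contractible_summand scale Y \<and>
       (\<exists>r s. \<not> zero_bimod (obj Y r) \<and> \<not> zero_bimod (obj Y s) \<and>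
          (\<forall>i. i < r \<or> s < i \<longrightarrow> zero_bimod (obj Y i)) \<and> int l = s - r))"

definition s_gl_dim :: "('k::field \<Rightarrow> 'a::ring_1 \<Rightarrow> 'a) \<Rightarrow> enat" where
  "s_gl_dim scale =
     Sup {enat l | l X. indecomposable homotopic (Cb scale) X \<and> has_length scale X l}"


section \<open>Tensor products of bimodules\<close>

text \<open>\<open>M \<otimes>\<^sub>S N\<close> is the free abelian group on \<open>M \<times> N\<close> modulo the subgroup generated by the
  usual relations; its elements are cosets of formal sums.\<close>

definition tensor_rels ::
  "'s set \<Rightarrow> ('l, 's, 'm) bimod \<Rightarrow> ('s, 'a, 'n) bimod \<Rightarrow> ('m \<times> 'n \<Rightarrow>\<^sub>0 int) set" where
  "tensor_rels S M N =
     {frag_of (x \<oplus>\<^bsub>M\<^esub> x', y) - (frag_of (x, y) + frag_of (x', y)) | x x' y.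
        x \<in> carrier M \<and> x' \<in> carrier M \<and> y \<in> carrier N} \<union>
     {frag_of (x, y \<oplus>\<^bsub>N\<^esub> y') - (frag_of (x, y) + frag_of (x, y')) | x y y'.
        x \<in> carrier M \<and> y \<in> carrier N \<and> y' \<in> carrier N} \<union>
     {frag_of (ract M x s, y) - frag_of (x, lact N s y) | x s y.
        x \<in> carrier M \<and> s \<in> S \<and> y \<in> carrier N}"

abbreviation pair_sums ::
  "('l, 's, 'm) bimod \<Rightarrow> ('s, 'a, 'n) bimod \<Rightarrow> ('m \<times> 'n \<Rightarrow>\<^sub>0 int) monoid" where
  "pair_sums M N \<equiv> free_Abelian_group (carrier M \<times> carrier N)"

definition tensor_null ::
  "'s set \<Rightarrow> ('l, 's, 'm) bimod \<Rightarrow> ('s, 'a, 'n) bimod \<Rightarrow> ('m \<times> 'n \<Rightarrow>\<^sub>0 int) set" where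
  "tensor_null S M N = generate (pair_sums M N) (tensor_rels S M N)"

text \<open>The map into \<open>M \<otimes>\<^sub>S N\<close> that sends \<open>x \<otimes> y\<close> to \<open>x' \<otimes> y'\<close> where \<open>\<phi> (x, y) = (x', y')\<close>;
  it is used only for \<open>\<phi>\<close> compatible with the relations.\<close>

definition tensor_map ::
  "'s set \<Rightarrow> ('l, 's, 'm) bimod \<Rightarrow> ('s, 'a, 'n) bimod \<Rightarrow> ('p \<Rightarrow> 'm \<times> 'n) \<Rightarrow>
   ('p \<Rightarrow>\<^sub>0 int) set \<Rightarrow> ('m \<times> 'n \<Rightarrow>\<^sub>0 int) set" where
  "tensor_map S M N \<phi> C =
     (\<Union>u\<in>C. tensor_null S M N #>\<^bsub>pair_sums M N\<^esub> frag_extend (frag_of \<circ> \<phi>) u)"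

definition tensor ::
  "'s set \<Rightarrow> ('l, 's, 'm) bimod \<Rightarrow> ('s, 'a, 'n) bimod \<Rightarrow> ('l, 'a, ('m \<times> 'n \<Rightarrow>\<^sub>0 int) set) bimod" where
  "tensor S M N =
    \<lparr>carrier = carrier (pair_sums M N Mod tensor_null S M N), monoid.mult = undefined, one = undefined,
     ring.zero = \<one>\<^bsub>pair_sums M N Mod tensor_null S M N\<^esub>,
     ring.add = (\<lambda>C D. C \<otimes>\<^bsub>pair_sums M N Mod tensor_null S M N\<^esub> D),
     lact = (\<lambda>l. tensor_map S M N (\<lambda>(x, y). (lact M l x, y))),
     ract = (\<lambda>C a. tensor_map S M N (\<lambda>(x, y). (x, ract N y a)) C)\<rparr>"


section \<open>One-parameter families\<close>

text \<open>\<open>R = k[x]\<^sub>h\<close> is realized inside the field \<open>k(x)\<close>, for \<open>h \<noteq> 0\<close>.\<close>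

definition loc :: "'k::field poly \<Rightarrow> 'k poly fract set" where
  "loc h = {Fract p (h ^ t) | p t. True}"

definition loc_bimod :: "'k::field poly \<Rightarrow> ('k poly fract, 'k, 'k poly fract) bimod" where
  "loc_bimod h =
    \<lparr>carrier = loc h, monoid.mult = undefined, one = undefined, ring.zero = 0, ring.add = (+),
     lact = (*), ract = (\<lambda>r c. r * Fract [:c:] 1)\<rparr>"

text \<open>\<open>k[x]/(x - c)\<close> as a \<open>k\<close>-\<open>R\<close>-bimodule, where \<open>R = k[x]\<^sub>h\<close> and \<open>h(c) \<noteq> 0\<close>. As \<open>h\<close> is a
  unit modulo \<open>x - c\<close>, the fraction \<open>p / h\<^sup>t\<close> takes the class of \<open>f\<close> to the class of those \<open>g\<close>
  with \<open>h\<^sup>t g \<equiv> f p\<close>.\<close>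

definition residue_class :: "'k::field \<Rightarrow> 'k poly \<Rightarrow> 'k poly set" where
  "residue_class c f = {g. [:- c, 1:] dvd g - f}"

definition residue_bimod ::
  "'k::field poly \<Rightarrow> 'k \<Rightarrow> ('k, 'k poly fract, 'k poly set) bimod" where
  "residue_bimod h c =
    \<lparr>carrier = range (residue_class c), monoid.mult = undefined, one = undefined,
     ring.zero = residue_class c 0,
     ring.add = (\<lambda>C D. \<Union>f\<in>C. \<Union>g\<in>D. residue_class c (f + g)),
     lact = (\<lambda>a C. \<Union>f\<in>C. residue_class c (smult a f)),
     ract = (\<lambda>C r. {g. \<exists>f\<in>C. \<exists>p t. r = Fract p (h ^ t) \<and> [:- c, 1:] dvd h ^ t * g - f * p})\<rparr>"

text \<open>Families are complexes \<open>M\<close> of \<open>R\<close>-\<open>\<Lambda>\<close>-bimodules in degrees \<open>1, \<dots>, n\<close> with \<open>M\<^sup>i = R \<otimes>\<^sub>k P\<^sup>i\<close>; the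
  specialization of \<open>M\<close> at \<open>c\<close> is \<open>k[x]/(x - c) \<otimes>\<^sub>R M\<close>.\<close>

type_synonym ('k, 'a) family =
  "('k poly fract, 'a, ('k poly fract \<times> (nat \<Rightarrow> 'a) \<Rightarrow>\<^sub>0 int) set) cpx"

definition one_param_family ::
  "('k::field \<Rightarrow> 'a::ring_1 \<Rightarrow> 'a) \<Rightarrow> nat \<Rightarrow> 'k poly \<Rightarrow> ('k, 'a) family \<Rightarrow> bool" where
  "one_param_family scale n h M \<longleftrightarrow> h \<noteq> 0 \<and> complex_over (loc h) UNIV M \<and>
     (\<exists>P. (\<forall>i. proj_mod scale (P i)) \<and> (\<forall>i. i \<notin> {1..int n} \<longrightarrow> zero_bimod (P i)) \<and>
       (\<forall>i. obj M i = tensor UNIV (loc_bimod h) (P i)))"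

definition specialization ::
  "'k::field poly \<Rightarrow> 'k \<Rightarrow> ('k, 'a) family \<Rightarrow>
   ('k, 'a, ('k poly set \<times> ('k poly fract \<times> (nat \<Rightarrow> 'a) \<Rightarrow>\<^sub>0 int) set \<Rightarrow>\<^sub>0 int) set) cpx" where
  "specialization h c M =
    \<lparr>obj = (\<lambda>i. tensor (loc h) (residue_bimod h c) (obj M i)),
     diff = (\<lambda>i. tensor_map (loc h) (residue_bimod h c) (obj M (i + 1))
                   (\<lambda>(f, y). (f, diff M i y)))\<rparr>"


section \<open>Tameness\<close>

text \<open>\<open>C\<^sub>n(proj \<Lambda>)\<close> is of tame representation type; finite representation type is included
  (\<open>\<F> = {}\<close>). \<open>\<E>\<close> represents the finitely many exceptional isomorphism classes.\<close>

definition tame :: "('k::field \<Rightarrow> 'a::ring_1 \<Rightarrow> 'a) \<Rightarrow> nat \<Rightarrow> bool" where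
  "tame scale n \<longleftrightarrow>
     (\<forall>m :: int \<Rightarrow> nat. \<exists>\<E> \<F>. finite \<E> \<and> \<E> \<subseteq> Cn scale n \<and>
        finite \<F> \<and> (\<forall>(h, M)\<in>\<F>. one_param_family scale n h M) \<and>
        (\<forall>X. indecomposable same_map (Cn scale n) X \<and> (\<forall>i\<in>{1..int n}. has_dim (obj X i) (m i)) \<longrightarrow>
           (\<exists>Y\<in>\<E>. iso_C X Y) \<or>
           (\<exists>(h, M)\<in>\<F>. \<exists>c. poly h c \<noteq> 0 \<and> iso_C X (specialization h c M))))"

end

theory Submission
  imports Defs "HOL-Library.Function_Algebras"
begin

text \<open>The content is that an indecomposable complex cannot be longer than the strong global dimension
  permits: if \<open>X\<close> is indecomposable in some \<open>C\<^sub>n(proj \<Lambda>)\<close>, then its support lies in an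
  interval \<open>{r..r + \<eta>}\<close>, so that a shift of \<open>X\<close> by some \<open>t < n\<close> is an indecomposable object of
  \<open>C\<^bsub>\<eta> + 1\<^esub>(proj \<Lambda>)\<close> (\<open>indecomposable_support\<close>, \<open>indecomposable_shift_into_window\<close>). For a
  fixed vector of dimensions only finitely many shifts \<open>t\<close> occur, and each of them
  gives one vector of dimensions for \<open>C\<^bsub>\<eta> + 1\<^esub>(proj \<Lambda>)\<close>. Shifting back the finitely many
  exceptional complexes and families for these vectors proves that \<open>C\<^sub>n(proj \<Lambda>)\<close> is tame.

  The bound on the support has two cases. If \<open>X\<close> is contractible, then its lowest differential
  is a split monomorphism, so a complex \<open>X\<^sup>r \<rightarrow> X\<^sup>r\<close> with identity differential
  splits off and \<open>X\<close> lives in two consecutive degrees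
  (\<open>contractible_indecomposable_support\<close>); here \<open>\<eta> \<ge> 1\<close> is needed. If \<open>X\<close> is not contractible,
  it is indecomposable in the homotopy category as well (\<open>indecomposable_homotopic\<close>) and it is its
  own representative without contractible summands
  (\<open>indecomposable_no_contractible_summand\<close>), so its length is one of those over which the
  supremum \<open>\<eta>\<close> is taken. The passage to the homotopy category rests on Fitting's lemma for
  complexes: an endomorphism of an indecomposable complex is nilpotent or invertible
  (\<open>indecomposable_endomorphism\<close>). In particular this holds for a chain map
  that is idempotent up to homotopy, which is therefore homotopic to \<open>0\<close> or to the identity.

  One technical point concerns the families. A family on the degrees \<open>1, \<dots>, \<eta> + 1\<close>, shifted
  back by \<open>t\<close>, may reach beyond degree \<open>n\<close>. It is cut off there; since the complex \<open>X\<close> that it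
  has to represent vanishes above \<open>n\<close>, an isomorphism from \<open>X\<close> to a specialization survives the
  truncation (\<open>iso_C_truncated\<close>, \<open>one_param_family_window\<close>). It only has to be known that tensor
  products with a zero module are zero (\<open>tensor_zero\<close>).\<close>
section \<open>Homomorphisms of bimodules\<close>

lemma bimod_homD:
  assumes "f \<in> bimod_hom L A M N" "x \<in> carrier M"
  shows bimod_hom_closed: "f x \<in> carrier N"
    and bimod_hom_add: "y \<in> carrier M \<Longrightarrow> f (x \<oplus>\<^bsub>M\<^esub> y) = f x \<oplus>\<^bsub>N\<^esub> f y"
    and bimod_hom_lact: "l \<in> L \<Longrightarrow> f (lact M l x) = lact N l (f x)"
    and bimod_hom_ract: "a \<in> A \<Longrightarrow> f (ract M x a) = ract N (f x) a"
  using assms unfolding bimod_hom_def by auto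

lemma bimod_homI:
  assumes "\<And>x. x \<in> carrier M \<Longrightarrow> f x \<in> carrier N"
    and "\<And>x y. \<lbrakk>x \<in> carrier M; y \<in> carrier M\<rbrakk> \<Longrightarrow> f (x \<oplus>\<^bsub>M\<^esub> y) = f x \<oplus>\<^bsub>N\<^esub> f y"
    and "\<And>l x. \<lbrakk>l \<in> L; x \<in> carrier M\<rbrakk> \<Longrightarrow> f (lact M l x) = lact N l (f x)"
    and "\<And>a x. \<lbrakk>a \<in> A; x \<in> carrier M\<rbrakk> \<Longrightarrow> f (ract M x a) = ract N (f x) a"
  shows "f \<in> bimod_hom L A M N"
  using assms unfolding bimod_hom_def by auto

lemma bimod_hom_id: "(\<lambda>x. x) \<in> bimod_hom L A M M"
  by (rule bimod_homI) auto

lemma bimod_hom_comp: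
  assumes "f \<in> bimod_hom L A M N" "g \<in> bimod_hom L A N P"
  shows "(\<lambda>x. g (f x)) \<in> bimod_hom L A M P"
  by (rule bimod_homI) (use assms in \<open>simp_all add: bimod_homD\<close>)

context bimodule
begin

lemma lact_zero: "l \<in> L \<Longrightarrow> lact M l \<zero>\<^bsub>M\<^esub> = \<zero>\<^bsub>M\<^esub>"
  using lact_add[of l "\<zero>\<^bsub>M\<^esub>" "\<zero>\<^bsub>M\<^esub>"] lact_closed[of l "\<zero>\<^bsub>M\<^esub>"]
  by (simp add: add.l_cancel_one')

lemma ract_zero: "a \<in> A \<Longrightarrow> ract M \<zero>\<^bsub>M\<^esub> a = \<zero>\<^bsub>M\<^esub>"
  using add_ract[of a "\<zero>\<^bsub>M\<^esub>" "\<zero>\<^bsub>M\<^esub>"] ract_closed[of a "\<zero>\<^bsub>M\<^esub>"]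
  by (simp add: add.l_cancel_one')

lemma lact_neg: "\<lbrakk>l \<in> L; x \<in> carrier M\<rbrakk> \<Longrightarrow> lact M l (\<ominus>\<^bsub>M\<^esub> x) = \<ominus>\<^bsub>M\<^esub> lact M l x"
  using lact_add[of l "\<ominus>\<^bsub>M\<^esub> x" x] lact_closed[of l x] lact_closed[of l "\<ominus>\<^bsub>M\<^esub> x"]
  by (metis a_inv_closed l_neg lact_zero minus_equality)

lemma ract_neg: "\<lbrakk>a \<in> A; x \<in> carrier M\<rbrakk> \<Longrightarrow> ract M (\<ominus>\<^bsub>M\<^esub> x) a = \<ominus>\<^bsub>M\<^esub> ract M x a"
  using add_ract[of a "\<ominus>\<^bsub>M\<^esub> x" x] ract_closed[of a x] ract_closed[of a "\<ominus>\<^bsub>M\<^esub> x"]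
  by (metis a_inv_closed l_neg ract_zero minus_equality)

lemma add_eq_self: "\<lbrakk>x \<in> carrier M; x \<oplus>\<^bsub>M\<^esub> x = x\<rbrakk> \<Longrightarrow> x = \<zero>\<^bsub>M\<^esub>"
  by (simp add: add.l_cancel_one)

lemma bimod_hom_into_zero: "(\<lambda>x. \<zero>\<^bsub>M\<^esub>) \<in> bimod_hom L A N M"
  by (rule bimod_homI) (auto simp: lact_zero ract_zero)

lemma bimod_hom_plus:
  assumes "f \<in> bimod_hom L A N M" "g \<in> bimod_hom L A N M"
  shows "(\<lambda>x. f x \<oplus>\<^bsub>M\<^esub> g x) \<in> bimod_hom L A N M"
  by (rule bimod_homI)
    (use assms in \<open>simp_all add: bimod_homD lact_add add_ract a_ac\<close>)

lemma bimod_hom_neg: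
  assumes "f \<in> bimod_hom L A N M"
  shows "(\<lambda>x. \<ominus>\<^bsub>M\<^esub> f x) \<in> bimod_hom L A N M"
  by (rule bimod_homI)
    (use assms in \<open>simp_all add: bimod_homD lact_neg ract_neg minus_add\<close>)

lemma bimodule_submodule:
  assumes S: "S \<subseteq> carrier M" "\<zero>\<^bsub>M\<^esub> \<in> S"
    and cl: "\<And>x y. \<lbrakk>x \<in> S; y \<in> S\<rbrakk> \<Longrightarrow> x \<oplus>\<^bsub>M\<^esub> y \<in> S" "\<And>x. x \<in> S \<Longrightarrow> \<ominus>\<^bsub>M\<^esub> x \<in> S"
      "\<And>l x. \<lbrakk>l \<in> L; x \<in> S\<rbrakk> \<Longrightarrow> lact M l x \<in> S" "\<And>a x. \<lbrakk>a \<in> A; x \<in> S\<rbrakk> \<Longrightarrow> ract M x a \<in> S"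
  shows "bimodule L A (M\<lparr>carrier := S\<rparr>)"
proof -
  have mem: "x \<in> carrier M" if "x \<in> S" for x
    using S that by auto
  have "abelian_group (M\<lparr>carrier := S\<rparr>)"
  proof (rule abelian_groupI)
    fix x assume "x \<in> carrier (M\<lparr>carrier := S\<rparr>)"
    then show "\<exists>y\<in>carrier (M\<lparr>carrier := S\<rparr>). y \<oplus>\<^bsub>M\<lparr>carrier := S\<rparr>\<^esub> x = \<zero>\<^bsub>M\<lparr>carrier := S\<rparr>\<^esub>"
      using cl(2) mem by (intro bexI[of _ "\<ominus>\<^bsub>M\<^esub> x"]) (simp_all add: l_neg)
  qed (use S cl mem in \<open>simp_all add: a_ac\<close>)
  then show ?thesis
    unfolding bimodule_def bimodule_axioms_def
    by (auto simp: cl mem lact_add add_lact lact_lact lact_one add_ract ract_add ract_ract ract_one lact_ract)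
qed

end

lemma bimod_hom_zero:
  assumes "bimodule L A M" "bimodule L A N" "f \<in> bimod_hom L A M N"
  shows "f \<zero>\<^bsub>M\<^esub> = \<zero>\<^bsub>N\<^esub>"
proof -
  interpret M: bimodule L A M by fact
  interpret N: bimodule L A N by fact
  show ?thesis
    by (metis assms(3) M.r_zero M.zero_closed N.add_eq_self bimod_hom_add bimod_hom_closed)
qed

lemma bimod_hom_uminus:
  assumes "bimodule L A M" "bimodule L A N" "f \<in> bimod_hom L A M N" "x \<in> carrier M"
  shows "f (\<ominus>\<^bsub>M\<^esub> x) = \<ominus>\<^bsub>N\<^esub> f x"
proof -
  interpret M: bimodule L A M by fact
  interpret N: bimodule L A N by fact
  have "f (\<ominus>\<^bsub>M\<^esub> x) \<oplus>\<^bsub>N\<^esub> f x = \<zero>\<^bsub>N\<^esub>"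
    using bimod_hom_add[OF assms(3) M.a_inv_closed[OF assms(4)] assms(4)] M.l_neg[OF assms(4)]
      bimod_hom_zero[OF assms(1-3)] by simp
  then show ?thesis
    using assms(4) by (intro N.minus_equality[symmetric]) (simp_all add: bimod_hom_closed[OF assms(3)])
qed

section \<open>Complexes and homotopies\<close>

text \<open>The setting for the calculus of homotopies: adding and negating homotopies takes place in the
  additive groups of the terms.\<close>
definition module_complex :: "('k::field, 'a::ring_1, 'm) cpx \<Rightarrow> bool" where
  "module_complex X \<longleftrightarrow> complex_over UNIV UNIV X \<and> (\<forall>i. bimodule UNIV UNIV (obj X i))"

lemma module_complexD:
  assumes "module_complex X"
  shows module_complex_bimodule: "bimodule UNIV UNIV (obj X i)"
    and module_complex_abelian_group: "abelian_group (obj X i)"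
    and diff_hom: "diff X i \<in> mod_hom (obj X i) (obj X (i + 1))"
    and diff_hom_pred: "diff X (i - 1) \<in> mod_hom (obj X (i - 1)) (obj X i)"
    and diff_diff: "x \<in> carrier (obj X i) \<Longrightarrow> diff X (i + 1) (diff X i x) = \<zero>\<^bsub>obj X (i + 1 + 1)\<^esub>"
    and zero_closed: "\<zero>\<^bsub>obj X i\<^esub> \<in> carrier (obj X i)"
proof -
  have b: "\<And>i. bimodule UNIV UNIV (obj X i)"
    and d: "\<And>i. diff X i \<in> mod_hom (obj X i) (obj X (i + 1))"
    and dd: "\<And>i x. x \<in> carrier (obj X i) \<Longrightarrow> diff X (i + 1) (diff X i x) = \<zero>\<^bsub>obj X (i + 1 + 1)\<^esub>"
    using assms unfolding module_complex_def complex_over_def by blast+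
  show "bimodule UNIV UNIV (obj X i)" "diff X i \<in> mod_hom (obj X i) (obj X (i + 1))"
    by (rule b, rule d)
  show "diff X (i - 1) \<in> mod_hom (obj X (i - 1)) (obj X i)"
    using d[of "i - 1"] by (simp only: diff_add_cancel)
  show ab: "abelian_group (obj X i)"
    using b[of i] unfolding bimodule_def by blast
  then show "\<zero>\<^bsub>obj X i\<^esub> \<in> carrier (obj X i)"
    by (simp add: abelian_group.axioms(1) abelian_monoid.zero_closed)
  show "x \<in> carrier (obj X i) \<Longrightarrow> diff X (i + 1) (diff X i x) = \<zero>\<^bsub>obj X (i + 1 + 1)\<^esub>"
    by (rule dd)
qed

lemmas diff_closed = bimod_hom_closed[OF diff_hom]
lemmas diff_pred_closed = bimod_hom_closed[OF diff_hom_pred]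

lemma chain_mapD:
  assumes "f \<in> chain_map X Y"
  shows chain_map_hom: "f i \<in> mod_hom (obj X i) (obj Y i)"
    and chain_map_diff: "x \<in> carrier (obj X i) \<Longrightarrow> f (i + 1) (diff X i x) = diff Y i (f i x)"
  using assms by (auto simp: chain_map_def)

lemmas chain_map_closed = bimod_hom_closed[OF chain_map_hom]

lemma chain_map_zero:
  assumes "module_complex X" "module_complex Y" "f \<in> chain_map X Y"
  shows "f i \<zero>\<^bsub>obj X i\<^esub> = \<zero>\<^bsub>obj Y i\<^esub>"
  by (rule bimod_hom_zero[OF module_complex_bimodule[OF assms(1)] module_complex_bimodule[OF assms(2)]
        chain_map_hom[OF assms(3)]])

lemma chain_map_id: "id_map \<in> chain_map X X"
  by (auto simp: chain_map_def id_map_def bimod_hom_id)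

lemma chain_map_comp:
  assumes "f \<in> chain_map X Y" "g \<in> chain_map Y Z"
  shows "comp_map g f \<in> chain_map X Z"
  using assms unfolding chain_map_def comp_map_def o_def
  by (auto intro: bimod_hom_comp) (metis bimod_hom_closed)

lemma same_map_homotopic:
  assumes X: "module_complex X" and Y: "module_complex Y"
    and g: "g \<in> chain_map X Y" and eq: "same_map X Y f g"
  shows "homotopic X Y f g"
  unfolding homotopic_def
proof (intro exI conjI allI ballI)
  fix i
  show "(\<lambda>x. \<zero>\<^bsub>obj Y (i - 1)\<^esub>) \<in> mod_hom (obj X i) (obj Y (i - 1))"
    by (rule bimodule.bimod_hom_into_zero) (rule module_complex_bimodule[OF Y])
  fix x assume x: "x \<in> carrier (obj X i)"
  interpret bimodule UNIV UNIV "obj Y i" by (rule module_complex_bimodule[OF Y])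
  have "diff Y (i - 1) \<zero>\<^bsub>obj Y (i - 1)\<^esub> = \<zero>\<^bsub>obj Y i\<^esub>"
    by (rule bimod_hom_zero[OF module_complex_bimodule[OF Y] module_complex_bimodule[OF Y]
          diff_hom_pred[OF Y]])
  then show "f i x = g i x \<oplus>\<^bsub>obj Y i\<^esub> (diff Y (i - 1) \<zero>\<^bsub>obj Y (i - 1)\<^esub> \<oplus>\<^bsub>obj Y i\<^esub>
      \<zero>\<^bsub>obj Y (i + 1 - 1)\<^esub>)"
    using eq x chain_map_closed[OF g x] by (simp add: same_map_def)
qed

lemma homotopic_sym:
  assumes X: "module_complex X" and Y: "module_complex Y"
    and g: "g \<in> chain_map X Y" and h: "homotopic X Y f g"
  shows "homotopic X Y g f"
proof -
  obtain s where s: "\<And>i. s i \<in> mod_hom (obj X i) (obj Y (i - 1))"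
    and eq: "\<And>i x. x \<in> carrier (obj X i) \<Longrightarrow>
      f i x = g i x \<oplus>\<^bsub>obj Y i\<^esub> (diff Y (i - 1) (s i x) \<oplus>\<^bsub>obj Y i\<^esub> s (i + 1) (diff X i x))"
    using h unfolding homotopic_def by metis
  show ?thesis
    unfolding homotopic_def
  proof (intro exI conjI allI ballI)
    fix i
    show "(\<lambda>x. \<ominus>\<^bsub>obj Y (i - 1)\<^esub> s i x) \<in> mod_hom (obj X i) (obj Y (i - 1))"
      by (rule bimodule.bimod_hom_neg) (rule module_complex_bimodule[OF Y], rule s)
    fix x assume x: "x \<in> carrier (obj X i)"
    interpret bimodule UNIV UNIV "obj Y i" by (rule module_complex_bimodule[OF Y])
    have c: "s i x \<in> carrier (obj Y (i - 1))" "g i x \<in> carrier (obj Y i)"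
      by (rule bimod_hom_closed[OF s x] chain_map_closed[OF g x])+
    then have c': "diff Y (i - 1) (s i x) \<in> carrier (obj Y i)"
      by (simp add: diff_pred_closed[OF Y])
    have "s (i + 1) (diff X i x) \<in> carrier (obj Y (i + 1 - 1))"
      by (rule bimod_hom_closed[OF s diff_closed[OF X x]])
    then have c'': "s (i + 1) (diff X i x) \<in> carrier (obj Y i)" by simp
    have "diff Y (i - 1) (\<ominus>\<^bsub>obj Y (i - 1)\<^esub> s i x) = \<ominus>\<^bsub>obj Y i\<^esub> diff Y (i - 1) (s i x)"
      by (rule bimod_hom_uminus[OF module_complex_bimodule[OF Y] module_complex_bimodule[OF Y]
            diff_hom_pred[OF Y] c(1)])
    moreover have "g i x = (g i x \<oplus>\<^bsub>obj Y i\<^esub> u) \<oplus>\<^bsub>obj Y i\<^esub> \<ominus>\<^bsub>obj Y i\<^esub> u"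
      if "u \<in> carrier (obj Y i)" for u
      using c that by (simp add: a_assoc r_neg)
    note this[OF a_closed[OF c' c'']]
    ultimately show "g i x = f i x \<oplus>\<^bsub>obj Y i\<^esub> (diff Y (i - 1) (\<ominus>\<^bsub>obj Y (i - 1)\<^esub> s i x) \<oplus>\<^bsub>obj Y i\<^esub>
        \<ominus>\<^bsub>obj Y (i + 1 - 1)\<^esub> s (i + 1) (diff X i x))"
      using c' c'' by (simp only: eq[OF x] minus_add add_diff_cancel_right')
  qed
qed

lemma homotopic_trans:
  assumes X: "module_complex X" and Y: "module_complex Y"
    and h: "h \<in> chain_map X Y" and fg: "homotopic X Y f g" and gh: "homotopic X Y g h"
  shows "homotopic X Y f h"
proof -
  obtain s where s: "\<And>i. s i \<in> mod_hom (obj X i) (obj Y (i - 1))"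
    and eqs: "\<And>i x. x \<in> carrier (obj X i) \<Longrightarrow>
      f i x = g i x \<oplus>\<^bsub>obj Y i\<^esub> (diff Y (i - 1) (s i x) \<oplus>\<^bsub>obj Y i\<^esub> s (i + 1) (diff X i x))"
    using fg unfolding homotopic_def by metis
  obtain t where t: "\<And>i. t i \<in> mod_hom (obj X i) (obj Y (i - 1))"
    and eqt: "\<And>i x. x \<in> carrier (obj X i) \<Longrightarrow>
      g i x = h i x \<oplus>\<^bsub>obj Y i\<^esub> (diff Y (i - 1) (t i x) \<oplus>\<^bsub>obj Y i\<^esub> t (i + 1) (diff X i x))"
    using gh unfolding homotopic_def by metis
  show ?thesis
    unfolding homotopic_def
  proof (intro exI conjI allI ballI)
    fix i
    show "(\<lambda>x. s i x \<oplus>\<^bsub>obj Y (i - 1)\<^esub> t i x) \<in> mod_hom (obj X i) (obj Y (i - 1))"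
      by (rule bimodule.bimod_hom_plus) (rule module_complex_bimodule[OF Y], rule s, rule t)
    fix x assume x: "x \<in> carrier (obj X i)"
    interpret bimodule UNIV UNIV "obj Y i" by (rule module_complex_bimodule[OF Y])
    have c: "s i x \<in> carrier (obj Y (i - 1))" "t i x \<in> carrier (obj Y (i - 1))"
      "h i x \<in> carrier (obj Y i)"
      by (rule bimod_hom_closed[OF s x] bimod_hom_closed[OF t x] chain_map_closed[OF h x])+
    then have c': "diff Y (i - 1) (s i x) \<in> carrier (obj Y i)"
      "diff Y (i - 1) (t i x) \<in> carrier (obj Y i)"
      by (simp_all add: diff_pred_closed[OF Y])
    have "s (i + 1) (diff X i x) \<in> carrier (obj Y (i + 1 - 1))"
      "t (i + 1) (diff X i x) \<in> carrier (obj Y (i + 1 - 1))"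
      by (rule bimod_hom_closed[OF s diff_closed[OF X x]] bimod_hom_closed[OF t diff_closed[OF X x]])+
    then have c'': "s (i + 1) (diff X i x) \<in> carrier (obj Y i)"
      "t (i + 1) (diff X i x) \<in> carrier (obj Y i)" by simp_all
    have "diff Y (i - 1) (s i x \<oplus>\<^bsub>obj Y (i - 1)\<^esub> t i x) =
        diff Y (i - 1) (s i x) \<oplus>\<^bsub>obj Y i\<^esub> diff Y (i - 1) (t i x)"
      by (rule bimod_hom_add[OF diff_hom_pred[OF Y] c(1,2)])
    then show "f i x = h i x \<oplus>\<^bsub>obj Y i\<^esub> (diff Y (i - 1) (s i x \<oplus>\<^bsub>obj Y (i - 1)\<^esub> t i x) \<oplus>\<^bsub>obj Y i\<^esub>
        (s (i + 1) (diff X i x) \<oplus>\<^bsub>obj Y (i + 1 - 1)\<^esub> t (i + 1) (diff X i x)))"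
      using c c' c'' by (simp add: eqs[OF x] eqt[OF x] a_ac)
  qed
qed

lemma homotopic_comp_left:
  assumes X: "module_complex X" and Y: "module_complex Y"
    and f: "f' \<in> chain_map X Y" and g: "g \<in> chain_map Y Z" and h: "homotopic X Y f f'"
  shows "homotopic X Z (comp_map g f) (comp_map g f')"
proof -
  obtain s where s: "\<And>i. s i \<in> mod_hom (obj X i) (obj Y (i - 1))"
    and eq: "\<And>i x. x \<in> carrier (obj X i) \<Longrightarrow>
      f i x = f' i x \<oplus>\<^bsub>obj Y i\<^esub> (diff Y (i - 1) (s i x) \<oplus>\<^bsub>obj Y i\<^esub> s (i + 1) (diff X i x))"
    using h unfolding homotopic_def by metis
  show ?thesis
    unfolding homotopic_def
  proof (intro exI conjI allI ballI)
    fix i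
    show "(\<lambda>x. g (i - 1) (s i x)) \<in> mod_hom (obj X i) (obj Z (i - 1))"
      by (rule bimod_hom_comp[OF s chain_map_hom[OF g]])
    fix x assume x: "x \<in> carrier (obj X i)"
    interpret bimodule UNIV UNIV "obj Y i" by (rule module_complex_bimodule[OF Y])
    have c: "s i x \<in> carrier (obj Y (i - 1))" "f' i x \<in> carrier (obj Y i)"
      by (rule bimod_hom_closed[OF s x] chain_map_closed[OF f x])+
    then have c': "diff Y (i - 1) (s i x) \<in> carrier (obj Y i)"
      by (simp add: diff_pred_closed[OF Y])
    have "s (i + 1) (diff X i x) \<in> carrier (obj Y (i + 1 - 1))"
      by (rule bimod_hom_closed[OF s diff_closed[OF X x]])
    then have c'': "s (i + 1) (diff X i x) \<in> carrier (obj Y i)" by simp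
    have "g i (diff Y (i - 1) (s i x)) = diff Z (i - 1) (g (i - 1) (s i x))"
      using chain_map_diff[OF g c(1)] by simp
    then show "comp_map g f i x = comp_map g f' i x \<oplus>\<^bsub>obj Z i\<^esub>
        (diff Z (i - 1) (g (i - 1) (s i x)) \<oplus>\<^bsub>obj Z i\<^esub>
          g (i + 1 - 1) (s (i + 1) (diff X i x)))"
      using c c' c'' chain_map_hom[OF g, of i] by (simp add: eq[OF x] comp_map_def bimod_hom_add)
  qed
qed

lemma homotopic_comp_right:
  assumes X: "module_complex X"
    and g: "g \<in> chain_map X Y" and h: "homotopic Y Z f f'"
  shows "homotopic X Z (comp_map f g) (comp_map f' g)"
proof -
  obtain s where s: "\<And>i. s i \<in> mod_hom (obj Y i) (obj Z (i - 1))"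
    and eq: "\<And>i x. x \<in> carrier (obj Y i) \<Longrightarrow>
      f i x = f' i x \<oplus>\<^bsub>obj Z i\<^esub> (diff Z (i - 1) (s i x) \<oplus>\<^bsub>obj Z i\<^esub> s (i + 1) (diff Y i x))"
    using h unfolding homotopic_def by metis
  show ?thesis
    unfolding homotopic_def
  proof (intro exI conjI allI ballI)
    fix i
    show "(\<lambda>x. s i (g i x)) \<in> mod_hom (obj X i) (obj Z (i - 1))"
      by (rule bimod_hom_comp[OF chain_map_hom[OF g] s])
    fix x assume x: "x \<in> carrier (obj X i)"
    show "comp_map f g i x = comp_map f' g i x \<oplus>\<^bsub>obj Z i\<^esub>
        (diff Z (i - 1) (s i (g i x)) \<oplus>\<^bsub>obj Z i\<^esub> s (i + 1) (g (i + 1) (diff X i x)))"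
      using chain_map_closed[OF g x] chain_map_diff[OF g x] by (simp add: eq comp_map_def)
  qed
qed

section \<open>Ascending and descending chains\<close>

context vector_space
begin

text \<open>The ambient space may be infinite-dimensional here, as the function space that contains all free
  modules is; only the span of a finite set is known to contain the subspaces.\<close>
lemma subspace_eq_of_dim_le:
  assumes "subspace V" "V \<subseteq> W" "W \<subseteq> span T" "finite T" "dim W \<le> dim V"
  shows "V = W"
proof -
  obtain B where B: "B \<subseteq> V" "independent B" "V \<subseteq> span B" "card B = dim V"
    using basis_exists .
  obtain C where C: "B \<subseteq> C" "C \<subseteq> W" "independent C" "W \<subseteq> span C"
    using maximal_independent_subset_extend[of B W] B assms(2) by blast
  have "finite C"
    using independent_span_bound[OF assms(4) C(3)] C(2) assms(3) by blast
  moreover have "card C = dim W"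
    using C basis_card_eq_dim by blast
  ultimately have "B = C"
    using B(4) C(1) assms(5) by (metis card_seteq)
  then show ?thesis
    using C(4) span_minimal[OF B(1) assms(1)] assms(2) by blast
qed

lemma subspace_chain_stable:
  fixes U :: "nat \<Rightarrow> 'b set"
  assumes U: "\<And>j. subspace (U j)" "\<And>j. U j \<subseteq> span T" and T: "finite T"
    and chain: "mono U \<or> antimono U"
  shows "\<exists>N. \<forall>j\<ge>N. U j = U N"
  using chain
proof
  assume mono: "mono U"
  have "\<forall>j. dim (U j) < Suc (card T)"
    using dim_le_card U(2) T by (simp add: less_Suc_eq_le)
  then obtain N where N: "\<And>j. dim (U j) \<le> dim (U N)"
    using ex_has_greatest_nat[of "\<lambda>_. True" 0 "\<lambda>j. dim (U j)" "Suc (card T)"] by blast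
  have "U N = U j" if "j \<ge> N" for j
    by (rule subspace_eq_of_dim_le[OF U(1) monoD[OF mono that] U(2) T N])
  then show ?thesis by metis
next
  assume anti: "antimono U"
  obtain N where N: "\<And>j. dim (U N) \<le> dim (U j)"
    using ex_has_least_nat[of "\<lambda>_. True" 0 "\<lambda>j. dim (U j)"] by blast
  have "U j = U N" if "j \<ge> N" for j
    by (rule subspace_eq_of_dim_le[OF U(1) antimonoD[OF anti that] U(2) T N])
  then show ?thesis by metis
qed

end

lemma (in fd_algebra) vector_space_fun:
  "vector_space (\<lambda>c (v :: nat \<Rightarrow> 'a) i. scale c (v i))"
  by unfold_locales (auto simp: fun_eq_iff scale_right_distrib scale_left_distrib)

text \<open>The coordinate vectors with entries in a finite spanning set of the algebra span the free module.\<close>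
lemma (in fd_algebra) free_mod_finite_span:
  "\<exists>T. finite T \<and>
     carrier (free_mod scale n) \<subseteq> module.span (\<lambda>c (v :: nat \<Rightarrow> 'a) i. scale c (v i)) T"
proof -
  interpret F: vector_space "\<lambda>c (v :: nat \<Rightarrow> 'a) i. scale c (v i)"
    by (rule vector_space_fun)
  obtain B where B: "finite B" "span B = UNIV"
    using finite_dimensional by blast
  define e :: "nat \<Rightarrow> 'a \<Rightarrow> nat \<Rightarrow> 'a" where "e i a = (\<lambda>j. if j = i then a else 0)" for i a
  define T where "T = (\<lambda>(i, b). e i b) ` ({..<n} \<times> B)"
  have e: "e i a \<in> F.span T" if "i < n" for i a
  proof -
    have "a \<in> span B" by (simp add: B)
    then show ?thesis
    proof (induction rule: span_induct_alt)
      case base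
      have "e i 0 = 0" by (auto simp: e_def)
      then show ?case by (metis F.span_zero)
    next
      case (step c x y)
      have "e i x \<in> F.span T"
        by (rule F.span_base) (use step that in \<open>auto simp: T_def\<close>)
      moreover have "e i (scale c x + y) = (\<lambda>j. scale c (e i x j)) + e i y"
        by (auto simp: e_def fun_eq_iff)
      ultimately show ?case
        using step F.span_add F.span_scale by presburger
    qed
  qed
  have "carrier (free_mod scale n) \<subseteq> F.span T"
  proof
    fix v assume "v \<in> carrier (free_mod scale n)"
    then have v: "v i = 0" if "i \<ge> n" for i
      using that by (simp add: free_mod_def)
    have "(\<Sum>i<m. e i (v i)) j = (if j < m then v j else 0)" for m j
      by (induction m) (auto simp: e_def less_Suc_eq)
    then have "v = (\<Sum>i<n. e i (v i))"
      by (auto simp: fun_eq_iff v not_less)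
    also have "\<dots> \<in> F.span T"
      by (rule F.span_sum) (simp add: e)
    finally show "v \<in> F.span T" .
  qed
  moreover have "finite T"
    using B by (simp add: T_def)
  ultimately show ?thesis by blast
qed

lemma proj_mod_bimodule: "proj_mod scale P \<Longrightarrow> bimodule UNIV UNIV P"
  by (simp add: proj_mod_def right_module_def)

text \<open>A finitely generated projective module embeds into a free one, hence into a finite-dimensional
  vector space, where monotone chains of subspaces are stationary because their dimensions are.\<close>
lemma proj_mod_chain_stable:
  fixes scale :: "'k::field \<Rightarrow> 'a::ring_1 \<Rightarrow> 'a"
  assumes "fd_algebra scale" and P: "proj_mod scale P"
    and S: "\<And>j. S j \<subseteq> carrier P" "\<And>j. \<zero>\<^bsub>P\<^esub> \<in> S j"
      "\<And>j x y. \<lbrakk>x \<in> S j; y \<in> S j\<rbrakk> \<Longrightarrow> x \<oplus>\<^bsub>P\<^esub> y \<in> S j" "\<And>j c x. x \<in> S j \<Longrightarrow> lact P c x \<in> S j"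
    and chain: "mono S \<or> antimono S"
  shows "\<exists>N. \<forall>j\<ge>N. S j = S (N :: nat)"
proof -
  interpret fd_algebra scale by fact
  interpret F: vector_space "\<lambda>c (v :: nat \<Rightarrow> 'a) i. scale c (v i)"
    by (rule vector_space_fun)
  interpret P: bimodule UNIV UNIV P
    by (rule proj_mod_bimodule[OF P])
  obtain n \<iota> \<pi> where \<iota>: "\<iota> \<in> mod_hom P (free_mod scale n)"
    and ret: "\<And>x. x \<in> carrier P \<Longrightarrow> \<pi> (\<iota> x) = x"
    using P unfolding proj_mod_def by blast
  obtain T where T: "finite T" "carrier (free_mod scale n) \<subseteq> F.span T"
    using free_mod_finite_span by blast
  have sub: "x \<in> carrier P" if "x \<in> S j" for x j
    using S(1) that by blast
  have add: "\<iota> (x \<oplus>\<^bsub>P\<^esub> y) = \<iota> x + \<iota> y" if "x \<in> carrier P" "y \<in> carrier P" for x y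
    using bimod_hom_add[OF \<iota> that] by (auto simp: free_mod_def)
  have sc: "\<iota> (lact P c x) = (\<lambda>i. scale c (\<iota> x i))" if "x \<in> carrier P" for x c
    using bimod_hom_lact[OF \<iota> that, of c] by (auto simp: free_mod_def)
  have "\<iota> \<zero>\<^bsub>P\<^esub> = 0"
    using add[of "\<zero>\<^bsub>P\<^esub>" "\<zero>\<^bsub>P\<^esub>"] by (simp only: P.r_zero P.zero_closed) simp
  then have "F.subspace (\<iota> ` S j)" for j
    by (intro F.subspaceI)
      (use S sub in \<open>auto simp: add[symmetric] sc[symmetric] image_iff intro: bexI[of _ "\<zero>\<^bsub>P\<^esub>"]\<close>)
  moreover have "\<iota> ` S j \<subseteq> F.span T" for j
    using T(2) bimod_hom_closed[OF \<iota>] sub by blast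
  moreover have "mono (\<lambda>j. \<iota> ` S j) \<or> antimono (\<lambda>j. \<iota> ` S j)"
    using chain unfolding mono_def antimono_def by (meson image_mono)
  ultimately obtain N where N: "\<And>j. j \<ge> N \<Longrightarrow> \<iota> ` S j = \<iota> ` S N"
    using F.subspace_chain_stable[of "\<lambda>j. \<iota> ` S j" T] T(1) by blast
  have "inj_on \<iota> (carrier P)"
    by (metis inj_onI ret)
  then have "S j = S N" if "j \<ge> N" for j
    using N[OF that] S(1) by (metis inj_on_image_eq_iff)
  then show ?thesis by blast
qed

lemma bimod_hom_funpow: "f \<in> bimod_hom L A M M \<Longrightarrow> (f ^^ j) \<in> bimod_hom L A M M"
proof (induction j)
  case 0
  then show ?case by (simp add: bimod_hom_id id_def)
next
  case (Suc j)
  then show ?case using bimod_hom_comp[of "f ^^ j" L A M M f M] by (simp add: o_def)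
qed

lemma stable_conj:
  fixes A :: "nat \<Rightarrow> 'x" and B :: "nat \<Rightarrow> 'y"
  assumes "\<exists>N. \<forall>j\<ge>N. A j = A N" "\<exists>N. \<forall>j\<ge>N. B j = B N"
  shows "\<exists>N. \<forall>j\<ge>N. A j = A N \<and> B j = B N"
proof -
  obtain N N' where "\<forall>j\<ge>N. A j = A N" "\<forall>j\<ge>N'. B j = B N'"
    using assms by blast
  then have "A j = A (max N N') \<and> B j = B (max N N')" if "j \<ge> max N N'" for j
    using that by (metis max.bounded_iff max.cobounded1 max.cobounded2)
  then show ?thesis by blast
qed

text \<open>The images of the powers of an endomorphism form a descending chain of submodules, their kernels
  an ascending one.\<close>
lemma Fitting_stable:
  assumes "fd_algebra scale" and P: "proj_mod scale P" and f: "f \<in> mod_hom P P"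
  shows "\<exists>N. \<forall>j\<ge>N. (f ^^ j) ` carrier P = (f ^^ N) ` carrier P \<and>
    {x \<in> carrier P. (f ^^ j) x = \<zero>\<^bsub>P\<^esub>} = {x \<in> carrier P. (f ^^ N) x = \<zero>\<^bsub>P\<^esub>}"
proof -
  interpret P: bimodule UNIV UNIV P
    by (rule proj_mod_bimodule[OF P])
  note pow = bimod_hom_funpow[OF f]
  note f0 = bimod_hom_zero[OF P.bimodule_axioms P.bimodule_axioms f]
  note pow0 = bimod_hom_zero[OF P.bimodule_axioms P.bimodule_axioms pow]
  have "\<exists>N. \<forall>j\<ge>N. (f ^^ j) ` carrier P = (f ^^ N) ` carrier P"
  proof (rule proj_mod_chain_stable[OF assms(1) P])
    show "mono (\<lambda>j. (f ^^ j) ` carrier P) \<or> antimono (\<lambda>j. (f ^^ j) ` carrier P)"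
      by (rule disjI2, unfold decseq_Suc_iff)
        (auto simp: funpow_swap1 simp del: funpow.simps(2) simp: funpow_Suc_right bimod_hom_closed[OF f])
  next
    fix j show "\<zero>\<^bsub>P\<^esub> \<in> (f ^^ j) ` carrier P"
      using pow0[of j] by (metis P.zero_closed image_eqI)
  next
    fix j x y assume "x \<in> (f ^^ j) ` carrier P" "y \<in> (f ^^ j) ` carrier P"
    then show "x \<oplus>\<^bsub>P\<^esub> y \<in> (f ^^ j) ` carrier P"
      by (auto simp: bimod_hom_add[OF pow, symmetric])
  next
    fix j c x assume "x \<in> (f ^^ j) ` carrier P"
    then show "lact P c x \<in> (f ^^ j) ` carrier P"
      by (auto simp: bimod_hom_lact[OF pow, symmetric] P.lact_closed)
  qed (use bimod_hom_closed[OF pow] in auto)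
  moreover have "\<exists>N. \<forall>j\<ge>N. {x \<in> carrier P. (f ^^ j) x = \<zero>\<^bsub>P\<^esub>} = {x \<in> carrier P. (f ^^ N) x = \<zero>\<^bsub>P\<^esub>}"
  proof (rule proj_mod_chain_stable[OF assms(1) P])
    show "mono (\<lambda>j. {x \<in> carrier P. (f ^^ j) x = \<zero>\<^bsub>P\<^esub>}) \<or> antimono (\<lambda>j. {x \<in> carrier P. (f ^^ j) x = \<zero>\<^bsub>P\<^esub>})"
      by (rule disjI1, unfold incseq_Suc_iff) (auto simp: f0)
  qed (auto simp: pow0 bimod_hom_add[OF pow] bimod_hom_lact[OF pow] P.lact_closed P.lact_zero)
  ultimately show ?thesis
    by (rule stable_conj)
qed

section \<open>Splitting off images of idempotents\<close>

text \<open>The image of an idempotent chain map, with the module structure and the differential of the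
  ambient complex. All summands can thus be kept on the same underlying type, which the definition
  of indecomposability requires.\<close>
definition image_cpx :: "('l, 'a, 'm) cpx \<Rightarrow> (int \<Rightarrow> 'm \<Rightarrow> 'm) \<Rightarrow> ('l, 'a, 'm) cpx" where
  "image_cpx X E =
    \<lparr>obj = (\<lambda>i. (obj X i)\<lparr>carrier := E i ` carrier (obj X i)\<rparr>), diff = diff X\<rparr>"

lemma image_cpx_simps [simp]:
  "obj (image_cpx X E) i = (obj X i)\<lparr>carrier := E i ` carrier (obj X i)\<rparr>"
  "diff (image_cpx X E) = diff X"
  by (simp_all add: image_cpx_def)

lemma Cb_module_complex: "X \<in> Cb scale \<Longrightarrow> module_complex X"
  unfolding Cb_def module_complex_def by (blast intro: proj_mod_bimodule)

lemma Cb_proj_mod: "X \<in> Cb scale \<Longrightarrow> proj_mod scale (obj X i)"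
  by (simp add: Cb_def)

text \<open>A retract of a direct summand of a free module is again one: the retraction of the free module is
  followed by the idempotent.\<close>
lemma proj_mod_image:
  assumes P: "proj_mod scale P" and f: "f \<in> mod_hom P P"
    and idem: "\<And>x. x \<in> carrier P \<Longrightarrow> f (f x) = f x"
  shows "proj_mod scale (P\<lparr>carrier := f ` carrier P\<rparr>)"
proof -
  interpret P: bimodule UNIV UNIV P
    by (rule proj_mod_bimodule[OF P])
  note B = P.bimodule_axioms
  have sub: "f ` carrier P \<subseteq> carrier P"
    using bimod_hom_closed[OF f] by blast
  have "\<zero>\<^bsub>P\<^esub> \<in> f ` carrier P"
    using bimod_hom_zero[OF B B f] by (metis P.zero_closed image_eqI)
  then have bim: "bimodule UNIV UNIV (P\<lparr>carrier := f ` carrier P\<rparr>)"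
    by (intro P.bimodule_submodule sub)
      (auto simp: bimod_hom_add[OF f, symmetric] bimod_hom_uminus[OF B B f, symmetric]
        bimod_hom_lact[OF f, symmetric] bimod_hom_ract[OF f, symmetric] P.lact_closed P.ract_closed)
  obtain n \<iota> \<pi> where \<iota>: "\<iota> \<in> mod_hom P (free_mod scale n)"
    and \<pi>: "\<pi> \<in> mod_hom (free_mod scale n) P"
    and ret: "\<And>x. x \<in> carrier P \<Longrightarrow> \<pi> (\<iota> x) = x"
    using P unfolding proj_mod_def by blast
  have "\<iota> \<in> mod_hom (P\<lparr>carrier := f ` carrier P\<rparr>) (free_mod scale n)"
    using \<iota> sub unfolding bimod_hom_def by (auto simp: Pi_iff subset_iff)
  moreover have "(\<lambda>v. f (\<pi> v)) \<in> mod_hom (free_mod scale n) (P\<lparr>carrier := f ` carrier P\<rparr>)"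
    using bimod_hom_comp[OF \<pi> f] bimod_hom_closed[OF \<pi>] unfolding bimod_hom_def by auto
  moreover have "f (\<pi> (\<iota> x)) = x" if "x \<in> f ` carrier P" for x
    using that sub idem ret by auto
  moreover have "\<forall>c. \<forall>x\<in>carrier P. lact P c x = ract P x (scale c 1)"
    using P unfolding proj_mod_def right_module_def by blast
  ultimately show ?thesis
    using bim sub unfolding proj_mod_def right_module_def by (intro conjI exI bexI) auto
qed

lemma image_cpx_Cb:
  assumes X: "X \<in> Cb scale" and E: "E \<in> chain_map X X"
    and idem: "\<And>i x. x \<in> carrier (obj X i) \<Longrightarrow> E i (E i x) = E i x"
  shows "image_cpx X E \<in> Cb scale"
proof -
  note mc = Cb_module_complex[OF X]
  have sub: "E i x \<in> carrier (obj X i)" if "x \<in> carrier (obj X i)" for i x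
    by (rule chain_map_closed[OF E that])
  have "diff X i \<in> mod_hom (obj (image_cpx X E) i) (obj (image_cpx X E) (i + 1))" for i
  proof (rule bimod_homI)
    fix x assume "x \<in> carrier (obj (image_cpx X E) i)"
    then show "diff X i x \<in> carrier (obj (image_cpx X E) (i + 1))"
      by (auto simp: chain_map_diff[OF E, symmetric] diff_closed[OF mc])
  qed (auto simp: sub bimod_hom_add[OF diff_hom[OF mc]] bimod_hom_lact[OF diff_hom[OF mc]]
      bimod_hom_ract[OF diff_hom[OF mc]])
  then have "complex_over UNIV UNIV (image_cpx X E)"
    unfolding complex_over_def by (auto simp: sub diff_diff[OF mc])
  moreover have "proj_mod scale (obj (image_cpx X E) i)" for i
    using proj_mod_image[OF Cb_proj_mod[OF X] chain_map_hom[OF E] idem] by simp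
  moreover have "zero_bimod (obj (image_cpx X E) i)" if "zero_bimod (obj X i)" for i
    using that chain_map_zero[OF mc mc E] by (simp add: zero_bimod_def)
  ultimately show ?thesis
    using X unfolding Cb_def by blast
qed

text \<open>Besides \<open>E\<close>, also \<open>1 - E\<close> is an idempotent chain map, and \<open>X\<close> is the direct sum of the images
  of the two.\<close>
lemma indecomposable_idempotent:
  assumes ind: "indecomposable same_map (Cb scale) X" and E: "E \<in> chain_map X X"
    and idem: "\<And>i x. x \<in> carrier (obj X i) \<Longrightarrow> E i (E i x) = E i x"
  shows "(\<forall>i. \<forall>x\<in>carrier (obj X i). E i x = \<zero>\<^bsub>obj X i\<^esub>) \<or> (\<forall>i. \<forall>x\<in>carrier (obj X i). E i x = x)"
proof -
  have X: "X \<in> Cb scale"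
    using ind by (simp add: indecomposable_def)
  note mc = Cb_module_complex[OF X]
  have ab: "bimodule UNIV UNIV (obj X i)" for i
    by (rule module_complex_bimodule[OF mc])
  note grp = module_complex_abelian_group[OF mc]
  have cl: "E i x \<in> carrier (obj X i)" if "x \<in> carrier (obj X i)" for i x
    by (rule chain_map_closed[OF E that])
  define E' where "E' i x = x \<oplus>\<^bsub>obj X i\<^esub> \<ominus>\<^bsub>obj X i\<^esub> E i x" for i x
  have E'_hom: "E' i \<in> mod_hom (obj X i) (obj X i)" for i
    unfolding E'_def
    by (intro bimodule.bimod_hom_plus[OF ab] bimodule.bimod_hom_neg[OF ab] bimod_hom_id chain_map_hom[OF E])
  have E'_diff: "E' (i + 1) (diff X i x) = diff X i (E' i x)" if "x \<in> carrier (obj X i)" for i x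
  proof -
    interpret i: abelian_group "obj X i" by (rule grp)
    interpret i1: abelian_group "obj X (i + 1)" by (rule grp)
    show ?thesis
      using that by (simp add: E'_def cl bimod_hom_add[OF diff_hom[OF mc]] bimod_hom_uminus[OF ab ab diff_hom[OF mc]]
          chain_map_diff[OF E])
  qed
  have E': "E' \<in> chain_map X X"
    using E'_hom E'_diff by (simp add: chain_map_def)
  have EE': "E i (E' i x) = \<zero>\<^bsub>obj X i\<^esub>" and E'E: "E' i (E i x) = \<zero>\<^bsub>obj X i\<^esub>"
    and sum: "E i x \<oplus>\<^bsub>obj X i\<^esub> E' i x = x"
    and idem': "E' i (E' i x) = E' i x" if x: "x \<in> carrier (obj X i)" for i x
  proof -
    interpret i: abelian_group "obj X i" by (rule grp)
    show 1: "E i (E' i x) = \<zero>\<^bsub>obj X i\<^esub>"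
      using x by (simp add: E'_def cl bimod_hom_add[OF chain_map_hom[OF E]]
          bimod_hom_uminus[OF ab ab chain_map_hom[OF E]] idem i.r_neg)
    show "E' i (E i x) = \<zero>\<^bsub>obj X i\<^esub>"
      using x by (simp add: E'_def cl idem i.r_neg)
    show "E i x \<oplus>\<^bsub>obj X i\<^esub> E' i x = x"
      using x by (simp add: E'_def cl i.a_lcomm[of "E i x" x] i.r_neg)
    have "E' i x \<in> carrier (obj X i)"
      using x cl by (simp add: E'_def)
    moreover have "E' i (E' i x) = E' i x \<oplus>\<^bsub>obj X i\<^esub> \<ominus>\<^bsub>obj X i\<^esub> E i (E' i x)"
      by (simp add: E'_def[of i "E' i x"])
    moreover have "\<ominus>\<^bsub>obj X i\<^esub> \<zero>\<^bsub>obj X i\<^esub> = \<zero>\<^bsub>obj X i\<^esub>"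
      by (rule i.minus_equality) simp_all
    ultimately show "E' i (E' i x) = E' i x"
      using 1 by simp
  qed
  let ?Y = "image_cpx X E" and ?Z = "image_cpx X E'"
  have inc: "id_map \<in> chain_map (image_cpx X e) X" and proj: "e \<in> chain_map X (image_cpx X e)"
    if "e \<in> chain_map X X" for e
    using that unfolding chain_map_def bimod_hom_def by (auto simp: id_map_def Pi_iff)
  have "direct_sum same_map X ?Y ?Z"
    unfolding direct_sum_def
    by (rule bexI[OF _ inc[OF E]], rule bexI[OF _ proj[OF E]], rule bexI[OF _ inc[OF E']],
        rule bexI[OF _ proj[OF E']])
      (auto simp: same_map_def comp_map_def id_map_def zero_map_def add_map_def idem idem' EE' E'E sum)
  moreover have "?Y \<in> Cb scale" "?Z \<in> Cb scale"
    by (rule image_cpx_Cb[OF X E idem] image_cpx_Cb[OF X E' idem'], assumption)+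
  ultimately have "same_map ?Y ?Y id_map (zero_map ?Y) \<or> same_map ?Z ?Z id_map (zero_map ?Z)"
    using ind unfolding indecomposable_def by blast
  then show ?thesis
  proof
    assume "same_map ?Y ?Y id_map (zero_map ?Y)"
    then show ?thesis by (simp add: same_map_def id_map_def zero_map_def)
  next
    assume "same_map ?Z ?Z id_map (zero_map ?Z)"
    then have E'0: "E' i x = \<zero>\<^bsub>obj X i\<^esub>" if "x \<in> carrier (obj X i)" for i x
      using that by (simp add: same_map_def id_map_def zero_map_def)
    have "E i x = x" if x: "x \<in> carrier (obj X i)" for i x
    proof -
      interpret i: abelian_group "obj X i" by (rule grp)
      show ?thesis using sum[OF x] E'0[OF x] cl[OF x] by simp
    qed
    then show ?thesis by blast
  qed
qed

section \<open>Endomorphisms of indecomposable complexes\<close>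

text \<open>The hypotheses say that the image of \<open>F\<close> equals that of \<open>F\<^sup>2\<close>, and the kernel of \<open>F\<close>
  that of \<open>F\<^sup>2\<close>. So \<open>F\<close> permutes its image, and \<open>X\<close> is the sum of the image and the
  kernel of \<open>F\<close>. The idempotent \<open>E\<close> is the projection to the image: \<open>E x\<close> is the only element of
  the image with the same value under \<open>F\<close> as \<open>x\<close>. This uniqueness makes \<open>E\<close> additive and
  compatible with the actions and the differential.\<close>
lemma Fitting_idempotent:
  assumes X: "module_complex X" and F: "F \<in> chain_map X X"
    and im: "\<And>i x. x \<in> carrier (obj X i) \<Longrightarrow> \<exists>y\<in>carrier (obj X i). F i x = F i (F i y)"
    and ker: "\<And>i x. \<lbrakk>x \<in> carrier (obj X i); F i (F i x) = \<zero>\<^bsub>obj X i\<^esub>\<rbrakk> \<Longrightarrow> F i x = \<zero>\<^bsub>obj X i\<^esub>"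
  obtains E where "E \<in> chain_map X X"
    and "\<And>i x. x \<in> carrier (obj X i) \<Longrightarrow> E i (E i x) = E i x"
    and "\<And>i x. x \<in> carrier (obj X i) \<Longrightarrow> F i (E i x) = F i x"
    and "\<And>i x. x \<in> carrier (obj X i) \<Longrightarrow> E i x \<in> F i ` carrier (obj X i)"
    and "\<And>i. inj_on (F i) (F i ` carrier (obj X i))"
proof -
  note bim = module_complex_bimodule[OF X]
  note Fh = chain_map_hom[OF F]
  note Fc = bimod_hom_closed[OF Fh]
  have inj: "inj_on (F i) (F i ` carrier (obj X i))" for i
  proof (rule inj_onI, clarsimp)
    interpret i: bimodule UNIV UNIV "obj X i" by (rule bim)
    fix x y assume xy: "x \<in> carrier (obj X i)" "y \<in> carrier (obj X i)" "F i (F i x) = F i (F i y)"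
    let ?z = "x \<oplus>\<^bsub>obj X i\<^esub> \<ominus>\<^bsub>obj X i\<^esub> y"
    have Fz: "F i ?z = F i x \<oplus>\<^bsub>obj X i\<^esub> \<ominus>\<^bsub>obj X i\<^esub> F i y"
      using xy by (simp add: bimod_hom_add[OF Fh] bimod_hom_uminus[OF bim bim Fh])
    then have "F i (F i ?z) = \<zero>\<^bsub>obj X i\<^esub>"
      using xy by (simp add: bimod_hom_add[OF Fh] bimod_hom_uminus[OF bim bim Fh] Fc i.r_neg)
    then have "F i ?z = \<zero>\<^bsub>obj X i\<^esub>"
      using ker xy by simp
    then show "F i x = F i y"
      using Fz xy Fc i.minus_equality[of "F i x" "\<ominus>\<^bsub>obj X i\<^esub> F i y"] by simp
  qed
  define E where "E i x = (SOME y. y \<in> F i ` carrier (obj X i) \<and> F i y = F i x)" for i x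
  have E: "E i x \<in> F i ` carrier (obj X i) \<and> F i (E i x) = F i x" if x: "x \<in> carrier (obj X i)" for i x
    unfolding E_def by (rule someI_ex) (use im[OF x] in auto)
  note E_im = E[THEN conjunct1] and FE = E[THEN conjunct2]
  have E_eq: "E i x = y" if "x \<in> carrier (obj X i)" "y \<in> F i ` carrier (obj X i)" "F i y = F i x" for i x y
  proof (rule inj_onD[OF inj _ E_im[OF that(1)] that(2)])
    show "F i (E i x) = F i y"
      using FE[OF that(1)] that(3) by (rule trans[OF _ sym])
  qed
  have Ec: "E i x \<in> carrier (obj X i)" if "x \<in> carrier (obj X i)" for i x
    using E_im[OF that] by (auto simp: Fc)
  have "E i \<in> mod_hom (obj X i) (obj X i)" for i
  proof -
    interpret i: bimodule UNIV UNIV "obj X i" by (rule bim)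
    have add: "a \<oplus>\<^bsub>obj X i\<^esub> b \<in> F i ` carrier (obj X i)"
      if "a \<in> F i ` carrier (obj X i)" "b \<in> F i ` carrier (obj X i)" for a b
      using that by (auto simp: bimod_hom_add[OF Fh, symmetric])
    have la: "lact (obj X i) l a \<in> F i ` carrier (obj X i)" if "a \<in> F i ` carrier (obj X i)" for l a
      using that by (auto simp: bimod_hom_lact[OF Fh, symmetric] i.lact_closed)
    have ra: "ract (obj X i) a l \<in> F i ` carrier (obj X i)" if "a \<in> F i ` carrier (obj X i)" for l a
      using that by (auto simp: bimod_hom_ract[OF Fh, symmetric] i.ract_closed)
    show ?thesis
      by (rule bimod_homI; (rule E_eq)?)
        (simp_all add: Ec E_im FE add la ra bimod_hom_add[OF Fh] bimod_hom_lact[OF Fh]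
          bimod_hom_ract[OF Fh] i.lact_closed i.ract_closed)
  qed
  moreover have "E (i + 1) (diff X i x) = diff X i (E i x)" if x: "x \<in> carrier (obj X i)" for i x
  proof (rule E_eq)
    show "diff X i x \<in> carrier (obj X (i + 1))"
      by (rule diff_closed[OF X x])
    obtain z where "z \<in> carrier (obj X i)" "E i x = F i z"
      using E_im[OF x] by blast
    then show "diff X i (E i x) \<in> F (i + 1) ` carrier (obj X (i + 1))"
      by (simp add: chain_map_diff[OF F, symmetric] diff_closed[OF X])
    show "F (i + 1) (diff X i (E i x)) = F (i + 1) (diff X i x)"
      using x by (simp add: chain_map_diff[OF F] Ec FE)
  qed
  ultimately have "E \<in> chain_map X X"
    by (simp add: chain_map_def)
  moreover have "E i (E i x) = E i x" if "x \<in> carrier (obj X i)" for i x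
    by (rule E_eq) (simp_all add: that Ec E_im)
  ultimately show thesis
    by (rule that[OF _ _ FE E_im inj])
qed

lemma chain_map_funpow: "e \<in> chain_map X X \<Longrightarrow> (\<lambda>i. e i ^^ N) \<in> chain_map X X"
proof (induction N)
  case 0
  show ?case by (simp add: chain_map_def bimod_hom_id id_def)
next
  case (Suc N)
  then show ?case
    using chain_map_comp[of "\<lambda>i. e i ^^ N" X X e X] by (simp add: comp_map_def[abs_def] o_def)
qed

lemma chain_map_right_inverse:
  assumes f: "f \<in> chain_map X Y" and bij: "\<And>i. bij_betw (f i) (carrier (obj X i)) (carrier (obj Y i))"
    and X: "module_complex X"
  shows "\<exists>g\<in>chain_map Y X. same_map Y Y (comp_map f g) id_map"
proof -
  define g where "g i = inv_into (carrier (obj X i)) (f i)" for i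
  have gc: "g i y \<in> carrier (obj X i)" and fg: "f i (g i y) = y" if "y \<in> carrier (obj Y i)" for i y
    using bij_betw_imp_surj_on[OF bij[of i]] that
    by (auto simp: g_def inv_into_into f_inv_into_f)
  have g_eq: "g i y = x" if "x \<in> carrier (obj X i)" "f i x = y" for i x y
    using bij_betw_imp_inj_on[OF bij[of i]] that by (auto simp: g_def)
  note fh = chain_map_hom[OF f]
  have "g i \<in> mod_hom (obj Y i) (obj X i)" for i
  proof -
    interpret i: bimodule UNIV UNIV "obj X i" by (rule module_complex_bimodule[OF X])
    show ?thesis
      by (rule bimod_homI; (rule g_eq)?)
        (simp_all add: gc fg bimod_hom_add[OF fh] bimod_hom_lact[OF fh] bimod_hom_ract[OF fh]
          i.lact_closed i.ract_closed)
  qed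
  moreover have "g (i + 1) (diff Y i y) = diff X i (g i y)" if "y \<in> carrier (obj Y i)" for i y
    by (rule g_eq) (use that in \<open>simp_all add: gc fg chain_map_diff[OF f] diff_closed[OF X]\<close>)
  ultimately have "g \<in> chain_map Y X"
    by (simp add: chain_map_def)
  moreover have "same_map Y Y (comp_map f g) id_map"
    by (simp add: same_map_def comp_map_def id_map_def fg)
  ultimately show ?thesis by blast
qed

text \<open>Fitting's lemma. Boundedness of \<open>X\<close> yields one exponent \<open>N\<close> beyond which images and kernels
  of powers are stationary in all degrees at once. The projection to the image of \<open>e\<^sup>N\<close> is zero
  or the identity by indecomposability; in the first case \<open>e\<^sup>N = 0\<close>, in the second one \<open>e\<^sup>N\<close>,
  and with it \<open>e\<close>, is bijective.\<close>
theorem indecomposable_endomorphism: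
  assumes fd: "fd_algebra scale" and ind: "indecomposable same_map (Cb scale) X"
    and e: "e \<in> chain_map X X"
  shows "(\<exists>N. \<forall>i. \<forall>x\<in>carrier (obj X i). (e i ^^ N) x = \<zero>\<^bsub>obj X i\<^esub>) \<or>
    (\<exists>g\<in>chain_map X X. same_map X X (comp_map e g) id_map)"
proof -
  have X: "X \<in> Cb scale"
    using ind by (simp add: indecomposable_def)
  note mc = Cb_module_complex[OF X]
  obtain r s where rs: "\<And>i. i < r \<or> s < i \<Longrightarrow> zero_bimod (obj X i)"
    using X unfolding Cb_def by blast
  have "\<forall>i. \<exists>N. \<forall>j\<ge>N. (e i ^^ j) ` carrier (obj X i) = (e i ^^ N) ` carrier (obj X i) \<and>
      {x \<in> carrier (obj X i). (e i ^^ j) x = \<zero>\<^bsub>obj X i\<^esub>} = {x \<in> carrier (obj X i). (e i ^^ N) x = \<zero>\<^bsub>obj X i\<^esub>}"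
    by (intro allI Fitting_stable[OF fd Cb_proj_mod[OF X] chain_map_hom[OF e]])
  from choice[OF this] obtain M where M: "\<And>i j. j \<ge> M i \<Longrightarrow>
      (e i ^^ j) ` carrier (obj X i) = (e i ^^ M i) ` carrier (obj X i) \<and>
      {x \<in> carrier (obj X i). (e i ^^ j) x = \<zero>\<^bsub>obj X i\<^esub>} = {x \<in> carrier (obj X i). (e i ^^ M i) x = \<zero>\<^bsub>obj X i\<^esub>}"
    by blast
  \<comment> \<open>The sum bounds all \<open>M i\<close> with \<open>r \<le> i \<le> s\<close>; the successor makes \<open>e\<close> a factor of \<open>e\<^sup>N\<close>.\<close>
  define N where "N = Suc (\<Sum>i\<in>{r..s}. M i)"
  define F where "F i = e i ^^ N" for i
  have F: "F \<in> chain_map X X"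
    using chain_map_funpow[OF e] by (simp add: F_def[abs_def])
  have FF: "F i (F i x) = (e i ^^ (N + N)) x" for i x
    by (simp add: F_def funpow_add)
  have st: "(e i ^^ (N + N)) ` carrier (obj X i) = F i ` carrier (obj X i) \<and>
      {x \<in> carrier (obj X i). (e i ^^ (N + N)) x = \<zero>\<^bsub>obj X i\<^esub>} = {x \<in> carrier (obj X i). F i x = \<zero>\<^bsub>obj X i\<^esub>}" for i
  proof (cases "i \<in> {r..s}")
    case True
    then have "M i \<le> N"
      using member_le_sum[of i "{r..s}" M] by (simp add: N_def)
    then show ?thesis
      using M[of i N] M[of i "N + N"] by (simp add: F_def)
  next
    case False
    then have "carrier (obj X i) = {\<zero>\<^bsub>obj X i\<^esub>}"
      using rs[of i] by (auto simp: zero_bimod_def)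
    then show ?thesis
      using chain_map_zero[OF mc mc chain_map_funpow[OF e], of _ i] by (auto simp: F_def)
  qed
  obtain E where E: "E \<in> chain_map X X"
    and idem: "\<And>i x. x \<in> carrier (obj X i) \<Longrightarrow> E i (E i x) = E i x"
    and FE: "\<And>i x. x \<in> carrier (obj X i) \<Longrightarrow> F i (E i x) = F i x"
    and E_im: "\<And>i x. x \<in> carrier (obj X i) \<Longrightarrow> E i x \<in> F i ` carrier (obj X i)"
    and inj: "\<And>i. inj_on (F i) (F i ` carrier (obj X i))"
  proof (rule Fitting_idempotent[OF mc F])
    fix i x assume x: "x \<in> carrier (obj X i)"
    then have "F i x \<in> (e i ^^ (N + N)) ` carrier (obj X i)"
      using st[of i] by simp
    then show "\<exists>y\<in>carrier (obj X i). F i x = F i (F i y)"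
      by (auto simp: FF)
    show "F i x = \<zero>\<^bsub>obj X i\<^esub>" if "F i (F i x) = \<zero>\<^bsub>obj X i\<^esub>"
      using st[of i] that x by (auto simp: FF)
  qed (rule that)
  from indecomposable_idempotent[OF ind E idem] show ?thesis
  proof
    assume E0: "\<forall>i. \<forall>x\<in>carrier (obj X i). E i x = \<zero>\<^bsub>obj X i\<^esub>"
    have "F i x = \<zero>\<^bsub>obj X i\<^esub>" if "x \<in> carrier (obj X i)" for i x
      using FE[OF that] E0 that by (simp add: chain_map_zero[OF mc mc F])
    then show ?thesis by (auto simp: F_def)
  next
    assume E1: "\<forall>i. \<forall>x\<in>carrier (obj X i). E i x = x"
    have "bij_betw (e i) (carrier (obj X i)) (carrier (obj X i))" for i
    proof -
      have cl: "(e i ^^ j) x \<in> carrier (obj X i)" if "x \<in> carrier (obj X i)" for j x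
        by (rule chain_map_closed[OF chain_map_funpow[OF e] that])
      have im: "F i ` carrier (obj X i) = carrier (obj X i)"
      proof
        show "F i ` carrier (obj X i) \<subseteq> carrier (obj X i)"
          by (auto simp: chain_map_closed[OF F])
        show "carrier (obj X i) \<subseteq> F i ` carrier (obj X i)"
        proof
          fix x assume "x \<in> carrier (obj X i)"
          then show "x \<in> F i ` carrier (obj X i)"
            using E_im[of x i] E1 by simp
        qed
      qed
      have "inj_on (e i) (carrier (obj X i))"
      proof (rule inj_onI)
        fix x y assume xy: "x \<in> carrier (obj X i)" "y \<in> carrier (obj X i)" "e i x = e i y"
        then have "F i x = F i y"
          by (simp add: F_def N_def funpow_Suc_right del: funpow.simps(2))
        then show "x = y"
          using inj_onD[OF inj[of i, unfolded im]] xy by blast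
      qed
      moreover have "carrier (obj X i) \<subseteq> e i ` carrier (obj X i)"
      proof
        fix y assume "y \<in> carrier (obj X i)"
        then obtain x where "x \<in> carrier (obj X i)" "y = F i x"
          using im by blast
        then show "y \<in> e i ` carrier (obj X i)"
          by (auto simp: F_def N_def cl)
      qed
      ultimately show ?thesis
        unfolding bij_betw_def by (auto simp: chain_map_closed[OF e])
    qed
    then show ?thesis
      by (intro disjI2 chain_map_right_inverse[OF e _ mc])
  qed
qed

section \<open>Indecomposable complexes in the homotopy category\<close>

lemma comp_map_id [simp]: "comp_map f id_map = f" "comp_map id_map f = f"
  by (auto simp: comp_map_def id_map_def fun_eq_iff)

lemma comp_map_zero_left [simp]: "comp_map (zero_map Y) f = zero_map Y"
  by (auto simp: comp_map_def zero_map_def fun_eq_iff)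

lemma chain_map_zero_map:
  assumes "module_complex Y"
  shows "zero_map Y \<in> chain_map X Y"
  unfolding chain_map_def zero_map_def
proof (intro CollectI conjI allI ballI)
  note bim = module_complex_bimodule[OF assms]
  fix i
  show "(\<lambda>x. \<zero>\<^bsub>obj Y i\<^esub>) \<in> mod_hom (obj X i) (obj Y i)"
    by (rule bimodule.bimod_hom_into_zero[OF bim])
  show "\<zero>\<^bsub>obj Y (i + 1)\<^esub> = diff Y i \<zero>\<^bsub>obj Y i\<^esub>"
    by (rule bimod_hom_zero[OF bim bim diff_hom[OF assms], symmetric])
qed

lemma homotopic_funpow:
  assumes Y: "module_complex Y" and p: "p \<in> chain_map Y Y" "homotopic Y Y p id_map"
  shows "homotopic Y Y (\<lambda>i. p i ^^ m) id_map"
proof (induction m)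
  case 0
  show ?case
    by (rule same_map_homotopic[OF Y Y chain_map_id]) (simp add: same_map_def id_map_def)
next
  case (Suc m)
  have "homotopic Y Y (comp_map p (\<lambda>i. p i ^^ m)) (comp_map p id_map)"
    by (rule homotopic_comp_left[OF Y Y chain_map_id p(1) Suc])
  then have "homotopic Y Y (\<lambda>i. p i ^^ Suc m) p"
    by (simp add: comp_map_def[abs_def] id_map_def o_def)
  then show ?case
    by (rule homotopic_trans[OF Y Y chain_map_id _ p(2)])
qed

text \<open>Let \<open>X\<close> be the direct sum of \<open>Y\<close> and \<open>Z\<close> up to homotopy. Fitting's lemma applies to the chain
  map \<open>e = \<iota>Y \<pi>Y\<close>. If \<open>e\<^sup>N = 0\<close>, then \<open>(\<pi>Y \<iota>Y)\<^bsup>N + 1\<^esup> = \<pi>Y e\<^sup>N \<iota>Y = 0\<close>, while \<open>\<pi>Y \<iota>Y\<close>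
  is homotopic to the identity, so \<open>Y\<close> is contractible. If \<open>e g = 1\<close>, then the identity of \<open>Z\<close> is
  homotopic to \<open>\<pi>Z \<iota>Z = (\<pi>Z \<iota>Y) (\<pi>Y g \<iota>Z)\<close>, whose first factor is homotopic to zero, so \<open>Z\<close> is
  contractible.\<close>
lemma indecomposable_homotopic:
  assumes fd: "fd_algebra scale" and ind: "indecomposable same_map (Cb scale) X"
    and nc: "\<not> contractible_cpx X"
  shows "indecomposable homotopic (Cb scale) X"
proof -
  have X: "X \<in> Cb scale"
    using ind by (simp add: indecomposable_def)
  note mX = Cb_module_complex[OF X]
  have "homotopic Y Y id_map (zero_map Y) \<or> homotopic Z Z id_map (zero_map Z)"
    if Y: "Y \<in> Cb scale" and Z: "Z \<in> Cb scale" and sum: "direct_sum homotopic X Y Z" for Y Z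
  proof -
    note mY = Cb_module_complex[OF Y] and mZ = Cb_module_complex[OF Z]
    obtain \<iota>Y \<pi>Y \<iota>Z \<pi>Z where maps: "\<iota>Y \<in> chain_map Y X" "\<pi>Y \<in> chain_map X Y"
        "\<iota>Z \<in> chain_map Z X" "\<pi>Z \<in> chain_map X Z"
      and YY: "homotopic Y Y (comp_map \<pi>Y \<iota>Y) id_map" and ZZ: "homotopic Z Z (comp_map \<pi>Z \<iota>Z) id_map"
      and YZ: "homotopic Y Z (comp_map \<pi>Z \<iota>Y) (zero_map Z)"
      using sum unfolding direct_sum_def by blast
    let ?e = "comp_map \<iota>Y \<pi>Y"
    have "?e \<in> chain_map X X"
      by (rule chain_map_comp[OF maps(2,1)])
    from indecomposable_endomorphism[OF fd ind this] show ?thesis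
    proof
      assume "\<exists>N. \<forall>i. \<forall>x\<in>carrier (obj X i). (?e i ^^ N) x = \<zero>\<^bsub>obj X i\<^esub>"
      then obtain N where N: "\<And>i x. x \<in> carrier (obj X i) \<Longrightarrow> (?e i ^^ N) x = \<zero>\<^bsub>obj X i\<^esub>"
        by blast
      let ?p = "comp_map \<pi>Y \<iota>Y"
      have p: "?p \<in> chain_map Y Y"
        by (rule chain_map_comp[OF maps(1,2)])
      have "(?p i ^^ Suc m) y = \<pi>Y i ((?e i ^^ m) (\<iota>Y i y))" for i m y
        by (induction m) (simp_all add: comp_map_def)
      then have "same_map Y Y (zero_map Y) (\<lambda>i. ?p i ^^ Suc N)"
        by (simp add: same_map_def zero_map_def N chain_map_closed[OF maps(1)]
            chain_map_zero[OF mX mY maps(2)] del: funpow.simps)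
      then have "homotopic Y Y (zero_map Y) (\<lambda>i. ?p i ^^ Suc N)"
        by (rule same_map_homotopic[OF mY mY chain_map_funpow[OF p]])
      from homotopic_trans[OF mY mY chain_map_id this homotopic_funpow[OF mY p YY]]
      show ?thesis
        by (intro disjI1 homotopic_sym[OF mY mY chain_map_id])
    next
      assume "\<exists>g\<in>chain_map X X. same_map X X (comp_map ?e g) id_map"
      then obtain g where g: "g \<in> chain_map X X" and eg: "same_map X X (comp_map ?e g) id_map"
        by blast
      let ?h = "comp_map \<pi>Y (comp_map g \<iota>Z)"
      have h: "?h \<in> chain_map Z Y"
        by (rule chain_map_comp[OF chain_map_comp[OF maps(3) g] maps(2)])
      have q: "comp_map \<pi>Z \<iota>Z \<in> chain_map Z Z"
        by (rule chain_map_comp[OF maps(3,4)])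
      have zero: "zero_map Z \<in> chain_map Z Z"
        by (rule chain_map_zero_map[OF mZ])
      have "same_map Z Z (comp_map \<pi>Z \<iota>Z) (comp_map (comp_map \<pi>Z \<iota>Y) ?h)"
        using eg chain_map_closed[OF maps(3)] by (simp add: same_map_def comp_map_def id_map_def)
      then have 1: "homotopic Z Z (comp_map \<pi>Z \<iota>Z) (comp_map (comp_map \<pi>Z \<iota>Y) ?h)"
        by (rule same_map_homotopic[OF mZ mZ chain_map_comp[OF h chain_map_comp[OF maps(1,4)]]])
      have 2: "homotopic Z Z (comp_map (comp_map \<pi>Z \<iota>Y) ?h) (zero_map Z)"
        using homotopic_comp_right[OF mZ h YZ] by simp
      have 3: "homotopic Z Z id_map (comp_map \<pi>Z \<iota>Z)"
        by (rule homotopic_sym[OF mZ mZ chain_map_id ZZ])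
      show ?thesis
        by (intro disjI2 homotopic_trans[OF mZ mZ zero 3] homotopic_trans[OF mZ mZ zero 1] 2)
    qed
  qed
  then show ?thesis
    using X nc unfolding indecomposable_def contractible_cpx_def by blast
qed

lemma zero_bimodI:
  assumes "module_complex X" and "\<And>x. x \<in> carrier (obj X i) \<Longrightarrow> x = \<zero>\<^bsub>obj X i\<^esub>"
  shows "zero_bimod (obj X i)"
  unfolding zero_bimod_def using assms(2) zero_closed[OF assms(1), of i] by blast

lemma zero_cpx_iff:
  assumes "module_complex X"
  shows "zero_cpx X \<longleftrightarrow> same_map X X id_map (zero_map X)"
  using zero_closed[OF assms]
  by (auto simp: zero_cpx_def zero_bimod_def same_map_def id_map_def zero_map_def)

text \<open>If \<open>X\<close> is a direct sum of \<open>Y\<close> and \<open>Z\<close> with \<open>Y\<close> contractible, then \<open>Z\<close> cannot be zero, for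
  otherwise the identity of \<open>X\<close> would factor through \<open>Y\<close> and \<open>X\<close> would be contractible.\<close>
lemma indecomposable_no_contractible_summand:
  assumes ind: "indecomposable same_map (Cb scale) X" and nc: "\<not> contractible_cpx X"
  shows "no_contractible_summand scale X"
  unfolding no_contractible_summand_def
proof (intro ballI impI, elim conjE)
  fix Y Z assume Y: "Y \<in> Cb scale" and Z: "Z \<in> Cb scale" and sum: "direct_sum same_map X Y Z"
    and contr: "contractible_cpx Y"
  have X: "X \<in> Cb scale"
    using ind by (simp add: indecomposable_def)
  note mX = Cb_module_complex[OF X] and mY = Cb_module_complex[OF Y] and mZ = Cb_module_complex[OF Z]
  have "\<not> zero_cpx Z"
  proof
    assume "zero_cpx Z"
    obtain \<iota>Y \<pi>Y \<iota>Z \<pi>Z where maps: "\<iota>Y \<in> chain_map Y X" "\<pi>Y \<in> chain_map X Y"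
        "\<iota>Z \<in> chain_map Z X" "\<pi>Z \<in> chain_map X Z"
      and id: "same_map X X (add_map X (comp_map \<iota>Y \<pi>Y) (comp_map \<iota>Z \<pi>Z)) id_map"
      using sum unfolding direct_sum_def by blast
    have "x = \<iota>Y i (\<pi>Y i x)" if x: "x \<in> carrier (obj X i)" for i x
    proof -
      interpret i: abelian_group "obj X i"
        by (rule module_complex_abelian_group[OF mX])
      have "\<pi>Z i x = \<zero>\<^bsub>obj Z i\<^esub>"
        using chain_map_closed[OF maps(4) x] \<open>zero_cpx Z\<close> by (simp add: zero_cpx_def zero_bimod_def)
      then have "\<iota>Z i (\<pi>Z i x) = \<zero>\<^bsub>obj X i\<^esub>"
        by (simp add: chain_map_zero[OF mZ mX maps(3)])
      moreover have "\<iota>Y i (\<pi>Y i x) \<oplus>\<^bsub>obj X i\<^esub> \<iota>Z i (\<pi>Z i x) = x"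
        using id x by (simp add: same_map_def add_map_def comp_map_def id_map_def)
      ultimately show ?thesis
        using chain_map_closed[OF maps(1) chain_map_closed[OF maps(2) x]] by simp
    qed
    then have "same_map X X id_map (comp_map \<iota>Y \<pi>Y)"
      by (simp add: same_map_def comp_map_def id_map_def)
    then have 1: "homotopic X X id_map (comp_map \<iota>Y \<pi>Y)"
      by (rule same_map_homotopic[OF mX mX chain_map_comp[OF maps(2,1)]])
    have "homotopic X Y \<pi>Y (zero_map Y)"
      using homotopic_comp_right[OF mX maps(2) contr[unfolded contractible_cpx_def]] by simp
    from homotopic_comp_left[OF mX mY chain_map_zero_map[OF mY] maps(1) this]
    have 2: "homotopic X X (comp_map \<iota>Y \<pi>Y) (zero_map X)"
      using chain_map_zero[OF mY mX maps(1)] by (simp add: comp_map_def[abs_def] zero_map_def[abs_def] o_def)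
    have "homotopic X X id_map (zero_map X)"
      by (rule homotopic_trans[OF mX mX chain_map_zero_map[OF mX] 1 2])
    then show False
      using nc by (simp add: contractible_cpx_def)
  qed
  then show "zero_cpx Y"
    using ind Y Z sum unfolding indecomposable_def zero_cpx_iff[OF mY] zero_cpx_iff[OF mZ] by blast
qed

lemma Cb_support:
  assumes "X \<in> Cb scale" "\<not> zero_cpx X"
  obtains r s where "r \<le> s" "\<not> zero_bimod (obj X r)" "\<not> zero_bimod (obj X s)"
    and "\<And>i. i < r \<or> s < i \<Longrightarrow> zero_bimod (obj X i)"
proof -
  let ?A = "{i. \<not> zero_bimod (obj X i)}"
  obtain a b where "\<And>i. i < a \<or> b < i \<Longrightarrow> zero_bimod (obj X i)"
    using assms(1) unfolding Cb_def by blast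
  then have "?A \<subseteq> {a..b}"
    by force
  then have fin: "finite ?A"
    by (rule finite_subset) simp
  have ne: "?A \<noteq> {}"
    using assms(2) by (simp add: zero_cpx_def)
  show thesis
  proof
    show "Min ?A \<le> Max ?A" "\<not> zero_bimod (obj X (Min ?A))" "\<not> zero_bimod (obj X (Max ?A))"
      using Min_in[OF fin ne] Max_in[OF fin ne] Min_le[OF fin] by auto
    fix i assume "i < Min ?A \<or> Max ?A < i"
    then have "i \<notin> ?A"
      using Min_le[OF fin, of i] Max_ge[OF fin, of i] by (meson not_le)
    then show "zero_bimod (obj X i)"
      by simp
  qed
qed

text \<open>In the lowest degree \<open>r\<close> of \<open>X\<close>, a contracting homotopy \<open>s\<close> satisfies \<open>s d = 1\<close>. Hence the
  identity in degree \<open>r\<close>, \<open>d s\<close> in degree \<open>r + 1\<close> and zero elsewhere form an idempotent chain map.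
  It is not zero, so it is the identity of \<open>X\<close>.\<close>
lemma contractible_indecomposable_support:
  assumes ind: "indecomposable same_map (Cb scale) X" and contr: "contractible_cpx X"
    and low: "\<not> zero_bimod (obj X r)" "\<And>i. i < r \<Longrightarrow> zero_bimod (obj X i)"
    and i: "r + 1 < i"
  shows "zero_bimod (obj X i)"
proof -
  have X: "X \<in> Cb scale"
    using ind by (simp add: indecomposable_def)
  note mX = Cb_module_complex[OF X]
  have bim: "bimodule UNIV UNIV (obj X i)" for i
    by (rule module_complex_bimodule[OF mX])
  have d0: "diff X i \<zero>\<^bsub>obj X i\<^esub> = \<zero>\<^bsub>obj X (i + 1)\<^esub>" for i
    by (rule bimod_hom_zero[OF bim bim diff_hom[OF mX]])
  obtain s where s: "\<And>i. s i \<in> mod_hom (obj X i) (obj X (i - 1))"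
    and eq: "\<And>i x. x \<in> carrier (obj X i) \<Longrightarrow> x = \<zero>\<^bsub>obj X i\<^esub> \<oplus>\<^bsub>obj X i\<^esub>
      (diff X (i - 1) (s i x) \<oplus>\<^bsub>obj X i\<^esub> s (i + 1) (diff X i x))"
    using contr unfolding contractible_cpx_def homotopic_def id_map_def zero_map_def by blast
  have s1: "s (r + 1) \<in> mod_hom (obj X (r + 1)) (obj X r)"
    using s[of "r + 1"] by simp
  have below: "carrier (obj X (r - 1)) = {\<zero>\<^bsub>obj X (r - 1)\<^esub>}"
    using low(2)[of "r - 1"] by (simp add: zero_bimod_def)
  have sd: "s (r + 1) (diff X r x) = x" if x: "x \<in> carrier (obj X r)" for x
  proof -
    interpret r: bimodule UNIV UNIV "obj X r" by (rule bim)
    have "s r x = \<zero>\<^bsub>obj X (r - 1)\<^esub>"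
      using bimod_hom_closed[OF s x] below by simp
    then have "diff X (r - 1) (s r x) = \<zero>\<^bsub>obj X r\<^esub>"
      using d0[of "r - 1"] by simp
    then show ?thesis
      using eq[OF x] bimod_hom_closed[OF s1 diff_closed[OF mX x]] by simp
  qed
  define E where "E i = (if i = r then (\<lambda>x. x) else if i = r + 1 then (\<lambda>x. diff X r (s (r + 1) x))
    else (\<lambda>x. \<zero>\<^bsub>obj X i\<^esub>))" for i
  have "E i \<in> mod_hom (obj X i) (obj X i)" for i
    using bimod_hom_comp[OF s1 diff_hom[OF mX]] bimod_hom_id bimodule.bimod_hom_into_zero[OF bim]
    by (auto simp: E_def)
  moreover have "E (i + 1) (diff X i x) = diff X i (E i x)" if x: "x \<in> carrier (obj X i)" for i x
  proof -
    consider "i = r - 1" | "i = r" | "i = r + 1" | "i \<noteq> r - 1" "i \<noteq> r" "i \<noteq> r + 1"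
      by blast
    then show ?thesis
    proof cases
      case 1
      then have "x = \<zero>\<^bsub>obj X i\<^esub>"
        using x below by simp
      then show ?thesis
        using 1 by (simp add: E_def d0[of "r - 1", simplified])
    next
      case 2
      then show ?thesis
        using x by (simp add: E_def sd)
    next
      case 3
      then show ?thesis
        using x diff_diff[OF mX bimod_hom_closed[OF s1], of x] by (simp add: E_def)
    next
      case 4
      then show ?thesis
        by (auto simp: E_def d0)
    qed
  qed
  ultimately have E: "E \<in> chain_map X X"
    by (simp add: chain_map_def)
  have idem: "E i (E i x) = E i x" if "x \<in> carrier (obj X i)" for i x
    using that by (auto simp: E_def sd bimod_hom_closed[OF s1])
  from indecomposable_idempotent[OF ind E idem] show ?thesis
  proof
    assume "\<forall>i. \<forall>x\<in>carrier (obj X i). E i x = \<zero>\<^bsub>obj X i\<^esub>"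
    then have "x = \<zero>\<^bsub>obj X r\<^esub>" if "x \<in> carrier (obj X r)" for x
      using that by (metis E_def)
    then have "zero_bimod (obj X r)"
      by (rule zero_bimodI[OF mX])
    then show ?thesis
      using low(1) by simp
  next
    assume *: "\<forall>i. \<forall>x\<in>carrier (obj X i). E i x = x"
    have "x = \<zero>\<^bsub>obj X i\<^esub>" if "x \<in> carrier (obj X i)" for x
    proof -
      have "E i x = \<zero>\<^bsub>obj X i\<^esub>"
        using i by (simp add: E_def)
      then show ?thesis
        using * that by simp
    qed
    then show ?thesis
      by (rule zero_bimodI[OF mX])
  qed
qed

text \<open>The hypothesis \<open>\<eta> \<ge> 1\<close> covers the contractible indecomposable complexes, whose length is \<open>1\<close>
  and which are zero in the homotopy category, hence invisible to the strong global dimension.\<close>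
theorem indecomposable_support:
  assumes fd: "fd_algebra scale" and dim: "s_gl_dim scale \<le> enat \<eta>" and \<eta>: "\<eta> \<ge> 1"
    and ind: "indecomposable same_map (Cb scale) X"
  obtains r where "\<not> zero_bimod (obj X r)"
    and "\<And>i. i < r \<or> r + int \<eta> < i \<Longrightarrow> zero_bimod (obj X i)"
proof -
  have X: "X \<in> Cb scale" and "\<not> same_map X X id_map (zero_map X)"
    using ind by (simp_all add: indecomposable_def)
  note mX = Cb_module_complex[OF X]
  have "\<not> zero_cpx X"
    using \<open>\<not> same_map X X id_map (zero_map X)\<close> zero_cpx_iff[OF mX] by blast
  then obtain r s where rs: "r \<le> s" "\<not> zero_bimod (obj X r)" "\<not> zero_bimod (obj X s)"
    "\<And>i. i < r \<or> s < i \<Longrightarrow> zero_bimod (obj X i)"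
    using Cb_support[OF X] by metis
  have "s \<le> r + int \<eta>"
  proof (cases "contractible_cpx X")
    case True
    have "\<not> r + 1 < s"
      using contractible_indecomposable_support[OF ind True rs(2)] rs(3,4) by blast
    then show ?thesis
      using \<eta> by simp
  next
    case False
    have "homotopic X X (comp_map id_map id_map) id_map"
      by (rule same_map_homotopic[OF mX mX chain_map_id]) (simp add: same_map_def)
    then have "iso_K X X"
      unfolding iso_K_def using chain_map_id[of X] by blast
    then have "has_length scale X (nat (s - r))"
      unfolding has_length_def
      using X indecomposable_no_contractible_summand[OF ind False] rs
      by (intro bexI[of _ X] conjI exI[of _ r] exI[of _ s]) auto
    then have "enat (nat (s - r)) \<le> s_gl_dim scale"
      unfolding s_gl_dim_def using indecomposable_homotopic[OF fd ind False]
      by (intro Sup_upper) blast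
    then have "enat (nat (s - r)) \<le> enat \<eta>"
      using dim by (rule order_trans)
    then show ?thesis by simp
  qed
  then show thesis
    using that[OF rs(2)] rs(4) by force
qed

section \<open>Shifting complexes\<close>

text \<open>Unlike the usual suspension, this shift leaves the signs of the differentials unchanged; up to
  isomorphism that makes no difference.\<close>
definition shift_cpx :: "int \<Rightarrow> ('l, 'a, 'm) cpx \<Rightarrow> ('l, 'a, 'm) cpx" where
  "shift_cpx t X = \<lparr>obj = (\<lambda>i. obj X (i + t)), diff = (\<lambda>i. diff X (i + t))\<rparr>"

lemma shift_cpx_simps [simp]:
  "obj (shift_cpx t X) i = obj X (i + t)" "diff (shift_cpx t X) i = diff X (i + t)"
  by (simp_all add: shift_cpx_def)

lemma shift_cpx_inverse [simp]: "shift_cpx (- t) (shift_cpx t X) = X" "shift_cpx t (shift_cpx (- t) X) = X"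
  by (simp_all add: shift_cpx_def)

lemma complex_over_shift:
  assumes "complex_over L A X"
  shows "complex_over L A (shift_cpx t X)"
  unfolding complex_over_def
proof (intro conjI allI ballI)
  fix i
  have eq: "i + 1 + t = i + t + 1" "i + 1 + 1 + t = i + t + 1 + 1" by simp_all
  show "diff (shift_cpx t X) i \<in> bimod_hom L A (obj (shift_cpx t X) i) (obj (shift_cpx t X) (i + 1))"
    using assms unfolding complex_over_def shift_cpx_simps eq by blast
  fix x assume "x \<in> carrier (obj (shift_cpx t X) i)"
  then show "diff (shift_cpx t X) (i + 1) (diff (shift_cpx t X) i x) = \<zero>\<^bsub>obj (shift_cpx t X) (i + 1 + 1)\<^esub>"
    using assms unfolding complex_over_def shift_cpx_simps eq by blast
qed

lemma Cb_shift:
  assumes "X \<in> Cb scale"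
  shows "shift_cpx t X \<in> Cb scale"
proof -
  obtain r s where rs: "\<And>i. i < r \<or> s < i \<Longrightarrow> zero_bimod (obj X i)"
    using assms unfolding Cb_def by blast
  have "zero_bimod (obj (shift_cpx t X) i)" if "i < r - t \<or> s - t < i" for i
    using rs[of "i + t"] that by auto
  then have "\<exists>r s. \<forall>i. i < r \<or> s < i \<longrightarrow> zero_bimod (obj (shift_cpx t X) i)"
    by blast
  then show ?thesis
    using assms complex_over_shift[of UNIV UNIV X t] unfolding Cb_def by simp
qed

lemma chain_map_shift:
  assumes "f \<in> chain_map X Y"
  shows "(\<lambda>i. f (i + t)) \<in> chain_map (shift_cpx t X) (shift_cpx t Y)"
  unfolding chain_map_def
proof (intro CollectI conjI allI ballI)
  fix i
  have eq: "i + 1 + t = i + t + 1" by simp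
  show "f (i + t) \<in> mod_hom (obj (shift_cpx t X) i) (obj (shift_cpx t Y) i)"
    by (simp add: chain_map_hom[OF assms])
  fix x assume "x \<in> carrier (obj (shift_cpx t X) i)"
  then show "f (i + 1 + t) (diff (shift_cpx t X) i x) = diff (shift_cpx t Y) i (f (i + t) x)"
    unfolding eq shift_cpx_simps by (rule chain_map_diff[OF assms])
qed

lemma iso_C_shift:
  assumes "iso_C X Y"
  shows "iso_C (shift_cpx t X) (shift_cpx t Y)"
proof -
  obtain f g where fg: "f \<in> chain_map X Y" "g \<in> chain_map Y X"
      "same_map X X (comp_map g f) id_map" "same_map Y Y (comp_map f g) id_map"
    using assms unfolding iso_C_def by blast
  show ?thesis
    unfolding iso_C_def
    by (rule bexI[OF _ chain_map_shift[OF fg(1)]], rule bexI[OF _ chain_map_shift[OF fg(2)]])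
      (use fg(3,4) in \<open>simp add: same_map_def comp_map_def id_map_def\<close>)
qed

lemma iso_C_unshift: "iso_C (shift_cpx t X) Y \<Longrightarrow> iso_C X (shift_cpx (- t) Y)"
  using iso_C_shift[of "shift_cpx t X" Y "- t"] by simp

lemma direct_sum_shift:
  assumes "direct_sum same_map X Y Z"
  shows "direct_sum same_map (shift_cpx t X) (shift_cpx t Y) (shift_cpx t Z)"
proof -
  obtain \<iota>Y \<pi>Y \<iota>Z \<pi>Z where maps: "\<iota>Y \<in> chain_map Y X" "\<pi>Y \<in> chain_map X Y"
      "\<iota>Z \<in> chain_map Z X" "\<pi>Z \<in> chain_map X Z"
    and eqs: "same_map Y Y (comp_map \<pi>Y \<iota>Y) id_map" "same_map Z Z (comp_map \<pi>Z \<iota>Z) id_map"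
      "same_map Z Y (comp_map \<pi>Y \<iota>Z) (zero_map Y)" "same_map Y Z (comp_map \<pi>Z \<iota>Y) (zero_map Z)"
      "same_map X X (add_map X (comp_map \<iota>Y \<pi>Y) (comp_map \<iota>Z \<pi>Z)) id_map"
    using assms unfolding direct_sum_def by blast
  note sh = maps[THEN chain_map_shift]
  show ?thesis
    unfolding direct_sum_def
    by (rule bexI[OF _ sh(1)], rule bexI[OF _ sh(2)], rule bexI[OF _ sh(3)], rule bexI[OF _ sh(4)])
      (use eqs in \<open>simp add: same_map_def comp_map_def id_map_def zero_map_def add_map_def\<close>)
qed

lemma zero_object_shift:
  "same_map X X id_map (zero_map X) \<Longrightarrow>
    same_map (shift_cpx t X) (shift_cpx t X) id_map (zero_map (shift_cpx t X))"
  by (simp add: same_map_def id_map_def zero_map_def)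

lemma zero_object_shift_iff:
  "same_map (shift_cpx t X) (shift_cpx t X) id_map (zero_map (shift_cpx t X)) \<longleftrightarrow>
    same_map X X id_map (zero_map X)"
  using zero_object_shift[of X t] zero_object_shift[of "shift_cpx t X" "- t"] by auto

lemma indecomposable_shift:
  assumes "indecomposable same_map (Cb scale) X"
  shows "indecomposable same_map (Cb scale) (shift_cpx t X)"
  unfolding indecomposable_def
proof (intro conjI ballI impI)
  show "shift_cpx t X \<in> Cb scale"
    using assms by (simp add: indecomposable_def Cb_shift)
  show "\<not> same_map (shift_cpx t X) (shift_cpx t X) id_map (zero_map (shift_cpx t X))"
    using assms by (simp add: indecomposable_def zero_object_shift_iff)
  fix Y Z
  assume "Y \<in> Cb scale" "Z \<in> Cb scale" "direct_sum same_map (shift_cpx t X) Y Z"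
  then have "shift_cpx (- t) Y \<in> Cb scale" "shift_cpx (- t) Z \<in> Cb scale"
      "direct_sum same_map X (shift_cpx (- t) Y) (shift_cpx (- t) Z)"
    using direct_sum_shift[of "shift_cpx t X" Y Z "- t"] by (simp_all add: Cb_shift)
  then have "same_map (shift_cpx (- t) Y) (shift_cpx (- t) Y) id_map (zero_map (shift_cpx (- t) Y)) \<or>
      same_map (shift_cpx (- t) Z) (shift_cpx (- t) Z) id_map (zero_map (shift_cpx (- t) Z))"
    using assms unfolding indecomposable_def by blast
  then show "same_map Y Y id_map (zero_map Y) \<or> same_map Z Z id_map (zero_map Z)"
    by (simp only: zero_object_shift_iff)
qed

lemma Cn_iff: "X \<in> Cn scale n \<longleftrightarrow> X \<in> Cb scale \<and> (\<forall>i. i \<notin> {1..int n} \<longrightarrow> zero_bimod (obj X i))"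
proof -
  have "\<exists>r s. \<forall>i. i < r \<or> s < i \<longrightarrow> zero_bimod (obj X i)"
    if "\<forall>i. i \<notin> {1..int n} \<longrightarrow> zero_bimod (obj X i)"
    by (rule exI[of _ 1], rule exI[of _ "int n"]) (use that in auto)
  then show ?thesis
    unfolding Cn_def Cb_def by blast
qed

lemma retract_zero:
  assumes X: "module_complex X" and Y: "module_complex Y"
    and f: "f \<in> chain_map Y X" and g: "g \<in> chain_map X Y"
    and gf: "same_map Y Y (comp_map g f) id_map" and zero: "zero_bimod (obj X i)"
  shows "zero_bimod (obj Y i)"
proof (rule zero_bimodI[OF Y])
  fix y assume y: "y \<in> carrier (obj Y i)"
  have "f i y = \<zero>\<^bsub>obj X i\<^esub>"
    using chain_map_closed[OF f y] zero by (simp add: zero_bimod_def)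
  moreover have "g i (f i y) = y"
    using gf y by (simp add: same_map_def comp_map_def id_map_def)
  ultimately show "y = \<zero>\<^bsub>obj Y i\<^esub>"
    by (simp add: chain_map_zero[OF X Y g])
qed

text \<open>A direct summand of a complex vanishes wherever the complex does, so it makes no difference
  whether decompositions are sought among all bounded complexes or in \<open>C\<^sub>n\<close>.\<close>
lemma indecomposable_Cn_iff:
  assumes X: "X \<in> Cn scale n"
  shows "indecomposable same_map (Cn scale n) X \<longleftrightarrow> indecomposable same_map (Cb scale) X"
proof -
  have Xb: "X \<in> Cb scale" and zero: "\<And>i. i \<notin> {1..int n} \<Longrightarrow> zero_bimod (obj X i)"
    using X by (auto simp: Cn_iff)
  note mX = Cb_module_complex[OF Xb]
  have "Y \<in> Cn scale n \<and> Z \<in> Cn scale n"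
    if Y: "Y \<in> Cb scale" and Z: "Z \<in> Cb scale" and sum: "direct_sum same_map X Y Z" for Y Z
  proof -
    obtain \<iota>Y \<pi>Y \<iota>Z \<pi>Z where maps: "\<iota>Y \<in> chain_map Y X" "\<pi>Y \<in> chain_map X Y"
        "\<iota>Z \<in> chain_map Z X" "\<pi>Z \<in> chain_map X Z"
      and eqs: "same_map Y Y (comp_map \<pi>Y \<iota>Y) id_map" "same_map Z Z (comp_map \<pi>Z \<iota>Z) id_map"
      using sum unfolding direct_sum_def by blast
    have "zero_bimod (obj Y i) \<and> zero_bimod (obj Z i)" if "i \<notin> {1..int n}" for i
      using retract_zero[OF mX Cb_module_complex[OF Y] maps(1,2) eqs(1) zero[OF that]]
        retract_zero[OF mX Cb_module_complex[OF Z] maps(3,4) eqs(2) zero[OF that]] by blast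
    then show ?thesis
      using Y Z by (simp add: Cn_iff)
  qed
  moreover have "Cn scale n \<subseteq> Cb scale"
    by (auto simp: Cn_iff)
  ultimately show ?thesis
    using X Xb unfolding indecomposable_def by blast
qed

lemma has_dim_zero:
  assumes "bimodule UNIV UNIV M" "zero_bimod M"
  shows "has_dim M 0"
proof -
  interpret bimodule UNIV UNIV M by fact
  show ?thesis
    using assms(2) by (auto simp: has_dim_def zero_bimod_def bij_betw_def)
qed

section \<open>Tensor products\<close>

text \<open>These closure properties of the two factors make \<^const>\<open>tensor_null\<close> a subgroup of the
  free abelian group and the tensor product a set of cosets.\<close>
locale tensor_closed =
  fixes S :: "'s set" and M :: "('l, 's, 'm) bimod" and N :: "('s, 'a, 'n) bimod"
  assumes add_left: "\<lbrakk>x \<in> carrier M; x' \<in> carrier M\<rbrakk> \<Longrightarrow> x \<oplus>\<^bsub>M\<^esub> x' \<in> carrier M"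
    and act_left: "\<lbrakk>x \<in> carrier M; s \<in> S\<rbrakk> \<Longrightarrow> ract M x s \<in> carrier M"
    and add_right: "\<lbrakk>y \<in> carrier N; y' \<in> carrier N\<rbrakk> \<Longrightarrow> y \<oplus>\<^bsub>N\<^esub> y' \<in> carrier N"
    and act_right: "\<lbrakk>y \<in> carrier N; s \<in> S\<rbrakk> \<Longrightarrow> lact N s y \<in> carrier N"
begin

lemma tensor_rels_subset: "tensor_rels S M N \<subseteq> carrier (pair_sums M N)"
proof -
  have F: "frag_of (x, y) \<in> carrier (pair_sums M N)" if "x \<in> carrier M" "y \<in> carrier N" for x y
    using that by simp
  have P: "a + b \<in> carrier (pair_sums M N)" "a - b \<in> carrier (pair_sums M N)"
    if "a \<in> carrier (pair_sums M N)" "b \<in> carrier (pair_sums M N)" for a b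
    using that keys_add[of a b] keys_diff[of a b] by auto
  show ?thesis
    unfolding tensor_rels_def using add_left act_left add_right act_right
    by (auto intro!: P F simp del: carrier_free_Abelian_group_iff)
qed

lemma tensor_null_subgroup: "subgroup (tensor_null S M N) (pair_sums M N)"
  unfolding tensor_null_def
  by (rule group.generate_is_subgroup[OF group_free_Abelian_group tensor_rels_subset])

lemma tensor_null_normal: "tensor_null S M N \<lhd> pair_sums M N"
  by (rule comm_group.subgroup_imp_normal[OF abelian_free_Abelian_group tensor_null_subgroup])

lemma tensor_carrier:
  "carrier (tensor S M N) =
    {tensor_null S M N #>\<^bsub>pair_sums M N\<^esub> v | v. v \<in> carrier (pair_sums M N)}"
  by (auto simp: tensor_def carrier_FactGroup)

lemma tensor_add_closed:
  assumes "C \<in> carrier (tensor S M N)" "D \<in> carrier (tensor S M N)"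
  shows "C \<oplus>\<^bsub>tensor S M N\<^esub> D \<in> carrier (tensor S M N)"
  using assms normal.setmult_closed[OF tensor_null_normal] by (simp add: tensor_def FactGroup_def)

lemma tensor_elem:
  assumes "C \<in> carrier (tensor S M N)"
  shows "C \<noteq> {}" "C \<subseteq> carrier (pair_sums M N)"
proof -
  obtain v where v: "v \<in> carrier (pair_sums M N)" "C = tensor_null S M N #>\<^bsub>pair_sums M N\<^esub> v"
    using assms by (auto simp: tensor_carrier)
  have "v \<in> C"
    unfolding v(2) by (rule group.rcos_self[OF group_free_Abelian_group v(1) tensor_null_subgroup])
  then show "C \<noteq> {}" by blast
  show "C \<subseteq> carrier (pair_sums M N)"
    unfolding v(2) by (rule monoid.r_coset_subset_G[OF group.is_monoid[OF group_free_Abelian_group]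
          subgroup.subset[OF tensor_null_subgroup] v(1)])
qed

text \<open>As \<open>\<phi>\<close> maps relations into the null subgroup, the union that defines \<^const>\<open>tensor_map\<close> runs
  over equal cosets.\<close>
lemma tensor_map_closed:
  assumes \<phi>: "\<And>x y. \<lbrakk>x \<in> carrier M; y \<in> carrier N\<rbrakk> \<Longrightarrow> \<phi> (x, y) \<in> carrier M \<times> carrier N"
    and rels: "\<And>r. r \<in> tensor_rels S M N \<Longrightarrow> frag_extend (frag_of \<circ> \<phi>) r \<in> tensor_null S M N"
    and C: "C \<in> carrier (tensor S M N)"
  shows "tensor_map S M N \<phi> C \<in> carrier (tensor S M N)"
proof -
  let ?G = "pair_sums M N" and ?H = "tensor_null S M N" and ?f = "frag_extend (frag_of \<circ> \<phi>)"
  note grp = group_free_Abelian_group[of "carrier M \<times> carrier N"]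
  have f_closed: "?f u \<in> carrier ?G" if "u \<in> carrier ?G" for u
    using that keys_frag_extend[of "frag_of \<circ> \<phi>" u] \<phi> by (fastforce simp: keys_frag_of)
  have f_null: "?f u \<in> ?H" if "u \<in> ?H" for u
    using that unfolding tensor_null_def
  proof (induction rule: generate.induct)
    case one
    show ?case by (simp add: generate.one[of ?G, simplified])
  next
    case (incl r)
    then show ?case using rels unfolding tensor_null_def by blast
  next
    case (inv r)
    then have "r \<in> carrier ?G"
      using tensor_rels_subset by blast
    then have "inv\<^bsub>?G\<^esub> r = - r" "inv\<^bsub>?G\<^esub> (?f r) = - ?f r"
      using f_closed[of r] by simp_all
    moreover have "inv\<^bsub>?G\<^esub> (?f r) \<in> ?H"
      by (rule subgroup.m_inv_closed[OF tensor_null_subgroup rels[OF inv]])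
    ultimately show ?case
      by (simp add: frag_extend_minus tensor_null_def o_def)
  next
    case (eng a b)
    then show ?case
      using generate.eng[of "?f a" ?G "tensor_rels S M N" "?f b"] by (simp add: frag_extend_add o_def)
  qed
  obtain v where v: "v \<in> carrier ?G" "C = ?H #>\<^bsub>?G\<^esub> v"
    using C by (auto simp: tensor_carrier)
  have "?H #>\<^bsub>?G\<^esub> ?f u = ?H #>\<^bsub>?G\<^esub> ?f v" if "u \<in> C" for u
  proof -
    obtain n where n: "n \<in> ?H" "u = n + v"
      using \<open>u \<in> C\<close> unfolding v(2) by (auto simp: r_coset_def)
    have "?f u \<in> ?H #>\<^bsub>?G\<^esub> ?f v"
      using n f_null by (auto simp: r_coset_def frag_extend_add)
    then show ?thesis
      by (rule group.repr_independence[OF grp _ f_closed[OF v(1)] tensor_null_subgroup, symmetric])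
  qed
  then have "tensor_map S M N \<phi> C = ?H #>\<^bsub>?G\<^esub> ?f v"
    unfolding tensor_map_def using tensor_elem(1)[OF C] by auto
  then show ?thesis
    using f_closed[OF v(1)] by (auto simp: tensor_carrier)
qed

lemma tensor_lact_closed:
  assumes l: "\<And>x. x \<in> carrier M \<Longrightarrow> lact M l x \<in> carrier M"
      "\<And>x x'. \<lbrakk>x \<in> carrier M; x' \<in> carrier M\<rbrakk> \<Longrightarrow> lact M l (x \<oplus>\<^bsub>M\<^esub> x') = lact M l x \<oplus>\<^bsub>M\<^esub> lact M l x'"
      "\<And>x s. \<lbrakk>x \<in> carrier M; s \<in> S\<rbrakk> \<Longrightarrow> lact M l (ract M x s) = ract M (lact M l x) s"
    and C: "C \<in> carrier (tensor S M N)"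
  shows "lact (tensor S M N) l C \<in> carrier (tensor S M N)"
proof -
  let ?\<phi> = "\<lambda>(x, y). (lact M l x, y)"
  have "frag_extend (frag_of \<circ> ?\<phi>) r \<in> tensor_rels S M N" if "r \<in> tensor_rels S M N" for r
    using that unfolding tensor_rels_def
  proof (elim UnE, goal_cases)
    case 1
    then obtain x x' y where "r = frag_of (x \<oplus>\<^bsub>M\<^esub> x', y) - (frag_of (x, y) + frag_of (x', y))"
      "x \<in> carrier M" "x' \<in> carrier M" "y \<in> carrier N" by blast
    then show ?case
      by (intro UnI1 CollectI exI[of _ "lact M l x"] exI[of _ "lact M l x'"] exI[of _ y])
        (simp add: frag_extend_diff frag_extend_add l)
  next
    case 2
    then obtain x y y' where "r = frag_of (x, y \<oplus>\<^bsub>N\<^esub> y') - (frag_of (x, y) + frag_of (x, y'))"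
      "x \<in> carrier M" "y \<in> carrier N" "y' \<in> carrier N" by blast
    then show ?case
      by (intro UnI1 UnI2 CollectI exI[of _ "lact M l x"] exI[of _ y] exI[of _ y'])
        (simp add: frag_extend_diff frag_extend_add l)
  next
    case 3
    then obtain x s y where "r = frag_of (ract M x s, y) - frag_of (x, lact N s y)"
      "x \<in> carrier M" "s \<in> S" "y \<in> carrier N" by blast
    then show ?case
      by (intro UnI2 CollectI exI[of _ "lact M l x"] exI[of _ s] exI[of _ y])
        (simp add: frag_extend_diff l)
  qed
  then have "tensor_map S M N ?\<phi> C \<in> carrier (tensor S M N)"
    using l C unfolding tensor_null_def by (intro tensor_map_closed) (auto intro: generate.incl simp: tensor_null_def)
  then show ?thesis
    by (simp add: tensor_def)
qed

text \<open>In a trivial tensor product every coset is the whole group, whatever \<open>\<phi>\<close> is. The set \<open>C\<close> may come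
  from another tensor product, as for a differential from a nonzero term to a zero term.\<close>
lemma tensor_map_into_zero:
  assumes null: "tensor_null S M N = carrier (pair_sums M N)" and ne: "C \<noteq> {}"
    and \<phi>: "\<And>u p. \<lbrakk>u \<in> C; p \<in> Poly_Mapping.keys u\<rbrakk> \<Longrightarrow> \<phi> p \<in> carrier M \<times> carrier N"
  shows "tensor_map S M N \<phi> C = \<zero>\<^bsub>tensor S M N\<^esub>"
proof -
  let ?G = "pair_sums M N" and ?H = "tensor_null S M N" and ?f = "frag_extend (frag_of \<circ> \<phi>)"
  have "?H #>\<^bsub>?G\<^esub> ?f u = ?H" if "u \<in> C" for u
  proof -
    have "?f u \<in> carrier ?G"
      using keys_frag_extend[of "frag_of \<circ> \<phi>" u] \<phi>[OF that] by (fastforce simp: keys_frag_of)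
    then show ?thesis
      by (intro group.coset_join2[OF group_free_Abelian_group _ tensor_null_subgroup]) (simp_all only: null)
  qed
  then show ?thesis
    using ne by (auto simp: tensor_map_def tensor_def)
qed

end

text \<open>Since \<open>0 + 0 = 0\<close>, biadditivity forces \<open>x \<otimes> 0 = 0\<close>, so every formal sum is null.\<close>
locale tensor_zero = tensor_closed +
  assumes zero_right: "carrier N = {\<zero>\<^bsub>N\<^esub>}"
begin

lemma tensor_null_eq: "tensor_null S M N = carrier (pair_sums M N)"
proof
  show "tensor_null S M N \<subseteq> carrier (pair_sums M N)"
    by (rule subgroup.subset[OF tensor_null_subgroup])
  note sub = tensor_null_subgroup
  have minus: "a - b \<in> tensor_null S M N" if "a \<in> tensor_null S M N" "b \<in> tensor_null S M N" for a b
  proof -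
    have "b \<in> carrier (pair_sums M N)"
      using that subgroup.subset[OF sub] by blast
    then show ?thesis
      using subgroup.m_closed[OF sub that(1) subgroup.m_inv_closed[OF sub that(2)]] by simp
  qed
  have 0: "0 \<in> tensor_null S M N"
    using subgroup.one_closed[OF sub] by simp
  have "frag_of p \<in> tensor_null S M N" if p: "p \<in> carrier M \<times> carrier N" for p
  proof -
    obtain x where x: "x \<in> carrier M" "p = (x, \<zero>\<^bsub>N\<^esub>)"
      using p zero_right by auto
    have "\<zero>\<^bsub>N\<^esub> \<oplus>\<^bsub>N\<^esub> \<zero>\<^bsub>N\<^esub> = \<zero>\<^bsub>N\<^esub>"
      using add_right[of "\<zero>\<^bsub>N\<^esub>" "\<zero>\<^bsub>N\<^esub>"] zero_right by simp
    then have "- frag_of p = frag_of (x, \<zero>\<^bsub>N\<^esub> \<oplus>\<^bsub>N\<^esub> \<zero>\<^bsub>N\<^esub>) - (frag_of (x, \<zero>\<^bsub>N\<^esub>) + frag_of (x, \<zero>\<^bsub>N\<^esub>))"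
      by (simp add: x(2))
    then have "- frag_of p \<in> tensor_rels S M N"
      unfolding tensor_rels_def using x(1) zero_right by blast
    then have "- frag_of p \<in> tensor_null S M N"
      unfolding tensor_null_def by (rule generate.incl)
    then show ?thesis
      using minus[OF 0] by fastforce
  qed
  then show "carrier (pair_sums M N) \<subseteq> tensor_null S M N"
    using free_Abelian_group_induct[of _ "carrier M \<times> carrier N" "\<lambda>u. u \<in> tensor_null S M N"] minus 0
    by auto
qed

lemma tensor_zero_carrier: "carrier (tensor S M N) = {\<zero>\<^bsub>tensor S M N\<^esub>}"
proof -
  have "tensor_null S M N #>\<^bsub>pair_sums M N\<^esub> v = tensor_null S M N" if "v \<in> carrier (pair_sums M N)" for v
    by (rule group.coset_join2[OF group_free_Abelian_group that tensor_null_subgroup])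
      (use that in \<open>simp only: tensor_null_eq\<close>)
  moreover have "0 \<in> carrier (pair_sums M N)"
    by simp
  ultimately show ?thesis
    unfolding tensor_carrier by (auto simp: tensor_def)
qed

lemma tensor_zero_add: "\<zero>\<^bsub>tensor S M N\<^esub> \<oplus>\<^bsub>tensor S M N\<^esub> \<zero>\<^bsub>tensor S M N\<^esub> = \<zero>\<^bsub>tensor S M N\<^esub>"
  using tensor_add_closed[of "\<zero>\<^bsub>tensor S M N\<^esub>" "\<zero>\<^bsub>tensor S M N\<^esub>"] tensor_zero_carrier by blast

lemma tensor_zero_elem: "\<zero>\<^bsub>tensor S M N\<^esub> \<noteq> {}" "\<zero>\<^bsub>tensor S M N\<^esub> \<subseteq> carrier (pair_sums M N)"
  using tensor_elem[of "\<zero>\<^bsub>tensor S M N\<^esub>"] tensor_zero_carrier by blast+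

lemma tensor_zero_lact:
  assumes "\<And>x. x \<in> carrier M \<Longrightarrow> lact M l x \<in> carrier M"
  shows "lact (tensor S M N) l \<zero>\<^bsub>tensor S M N\<^esub> = \<zero>\<^bsub>tensor S M N\<^esub>"
proof -
  have "tensor_map S M N (\<lambda>(x, y). (lact M l x, y)) \<zero>\<^bsub>tensor S M N\<^esub> = \<zero>\<^bsub>tensor S M N\<^esub>"
    by (rule tensor_map_into_zero[OF tensor_null_eq tensor_zero_elem(1)])
      (use tensor_zero_elem(2) assms in fastforce)
  then show ?thesis
    by (simp add: tensor_def)
qed

lemma tensor_zero_ract:
  assumes "ract N \<zero>\<^bsub>N\<^esub> a = \<zero>\<^bsub>N\<^esub>"
  shows "ract (tensor S M N) \<zero>\<^bsub>tensor S M N\<^esub> a = \<zero>\<^bsub>tensor S M N\<^esub>"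
proof -
  have "tensor_map S M N (\<lambda>(x, y). (x, ract N y a)) \<zero>\<^bsub>tensor S M N\<^esub> = \<zero>\<^bsub>tensor S M N\<^esub>"
    by (rule tensor_map_into_zero[OF tensor_null_eq tensor_zero_elem(1)])
      (use tensor_zero_elem(2) assms zero_right in fastforce)
  then show ?thesis
    by (simp add: tensor_def)
qed

end

lemma loc_closed:
  assumes "h \<noteq> 0" "a \<in> loc h" "b \<in> loc h"
  shows loc_add: "a + b \<in> loc h" and loc_mult: "a * b \<in> loc h"
proof -
  obtain p t q u where ab: "a = Fract p (h ^ t)" "b = Fract q (h ^ u)"
    using assms by (auto simp: loc_def)
  have "a + b = Fract (p * h ^ u + q * h ^ t) (h ^ (t + u))" "a * b = Fract (p * q) (h ^ (t + u))"
    using assms(1) by (simp_all add: ab power_add)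
  then show "a + b \<in> loc h" "a * b \<in> loc h"
    by (auto simp: loc_def)
qed

lemma loc_const: "Fract [:c:] 1 \<in> loc h"
  unfolding loc_def by (rule CollectI, rule exI[of _ "[:c:]"], rule exI[of _ 0]) simp

lemma tensor_closed_loc:
  assumes "h \<noteq> 0" "bimodule UNIV UNIV P"
  shows "tensor_closed UNIV (loc_bimod h) P"
proof -
  interpret P: bimodule UNIV UNIV P by fact
  show ?thesis
    by unfold_locales
      (auto simp: loc_bimod_def loc_add loc_mult loc_const assms(1) P.lact_closed)
qed

text \<open>In these terms, the fraction \<open>p / h\<^sup>t\<close> acts on \<open>k[x]/(x - c) \<cong> k\<close> as multiplication by
  \<open>p(c) / h(c)\<^sup>t\<close>.\<close>
lemma residue_class_eq: "residue_class c f = {g. poly g c = poly f c}"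
  by (auto simp: residue_class_def poly_eq_0_iff_dvd[symmetric])

lemma residue_closed:
  shows residue_add: "\<lbrakk>C \<in> carrier (residue_bimod h c); D \<in> carrier (residue_bimod h c)\<rbrakk> \<Longrightarrow>
      C \<oplus>\<^bsub>residue_bimod h c\<^esub> D \<in> carrier (residue_bimod h c)"
    and residue_lact: "C \<in> carrier (residue_bimod h c) \<Longrightarrow>
      lact (residue_bimod h c) a C \<in> carrier (residue_bimod h c)"
    and residue_ract: "\<lbrakk>poly h c \<noteq> 0; r \<in> loc h; C \<in> carrier (residue_bimod h c)\<rbrakk> \<Longrightarrow>
      ract (residue_bimod h c) C r \<in> carrier (residue_bimod h c)"
proof -
  show "C \<oplus>\<^bsub>residue_bimod h c\<^esub> D \<in> carrier (residue_bimod h c)"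
    if CD: "C \<in> carrier (residue_bimod h c)" "D \<in> carrier (residue_bimod h c)"
  proof -
    obtain f g where "C = residue_class c f" "D = residue_class c g"
      using CD by (auto simp: residue_bimod_def)
    then have "C \<oplus>\<^bsub>residue_bimod h c\<^esub> D = residue_class c (f + g)"
      by (auto simp: residue_bimod_def residue_class_eq)
    then show ?thesis
      by (simp add: residue_bimod_def)
  qed
  show "lact (residue_bimod h c) a C \<in> carrier (residue_bimod h c)"
    if C: "C \<in> carrier (residue_bimod h c)"
  proof -
    obtain f where "C = residue_class c f"
      using C by (auto simp: residue_bimod_def)
    then have "lact (residue_bimod h c) a C = residue_class c (smult a f)"
      by (auto simp: residue_bimod_def residue_class_eq)
    then show ?thesis
      by (simp add: residue_bimod_def)
  qed
  show "ract (residue_bimod h c) C r \<in> carrier (residue_bimod h c)"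
    if hc: "poly h c \<noteq> 0" and r: "r \<in> loc h" and C: "C \<in> carrier (residue_bimod h c)"
  proof -
    obtain f where f: "C = residue_class c f"
      using C by (auto simp: residue_bimod_def)
    obtain p t where p: "r = Fract p (h ^ t)"
      using r by (auto simp: loc_def)
    have h: "h \<noteq> 0"
      using hc by auto
    define a where "a = poly f c * poly p c / poly h c ^ t"
    \<comment> \<open>The value \<open>a\<close> depends neither on the fraction that represents \<open>r\<close> nor on the representative of \<open>C\<close>.\<close>
    have key: "[:- c, 1:] dvd h ^ u * g - f' * q \<longleftrightarrow> poly g c = a"
      if "poly f' c = poly f c" "r = Fract q (h ^ u)" for f' q u g
    proof -
      have "p * h ^ u = q * h ^ t"
        using p that(2) h by (simp add: eq_fract)
      then have "poly p c * poly h c ^ u = poly q c * poly h c ^ t"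
        by (metis poly_mult poly_power)
      then have "poly q c = poly p c * poly h c ^ u / poly h c ^ t"
        using hc by (simp add: field_simps)
      then have "a * poly h c ^ u = poly f c * poly q c"
        by (simp add: a_def)
      then have "poly f c * poly q c = poly h c ^ u * a"
        by (simp add: mult.commute)
      then show ?thesis
        using hc that(1) by (simp add: poly_eq_0_iff_dvd[symmetric])
    qed
    have "(\<exists>f'\<in>C. \<exists>q u. r = Fract q (h ^ u) \<and> [:- c, 1:] dvd h ^ u * g - f' * q) \<longleftrightarrow> poly g c = a" for g
    proof
      assume "poly g c = a"
      then have "[:- c, 1:] dvd h ^ t * g - f * p"
        using key[OF refl p] by blast
      then show "\<exists>f'\<in>C. \<exists>q u. r = Fract q (h ^ u) \<and> [:- c, 1:] dvd h ^ u * g - f' * q"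
        using p f by (auto simp: residue_class_eq)
    qed (use key f in \<open>auto simp: residue_class_eq\<close>)
    then have "ract (residue_bimod h c) C r = residue_class c [:a:]"
      by (simp add: residue_bimod_def residue_class_eq)
    then show ?thesis
      by (simp add: residue_bimod_def)
  qed
qed

lemma tensor_closed_residue:
  assumes "poly h c \<noteq> 0"
    and "\<And>y y'. \<lbrakk>y \<in> carrier N; y' \<in> carrier N\<rbrakk> \<Longrightarrow> y \<oplus>\<^bsub>N\<^esub> y' \<in> carrier N"
    and "\<And>r y. \<lbrakk>r \<in> loc h; y \<in> carrier N\<rbrakk> \<Longrightarrow> lact N r y \<in> carrier N"
  shows "tensor_closed (loc h) (residue_bimod h c) N"
  by unfold_locales (use assms in \<open>auto simp: residue_add residue_ract\<close>)

section \<open>Truncating and shifting families\<close>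

text \<open>Above degree \<open>n\<close> the terms are replaced by \<open>T\<close>, which is going to be a zero module.\<close>
definition truncate_cpx :: "int \<Rightarrow> ('l, 'a, 'm) bimod \<Rightarrow> ('l, 'a, 'm) cpx \<Rightarrow> ('l, 'a, 'm) cpx" where
  "truncate_cpx n T M =
    \<lparr>obj = (\<lambda>i. if i \<le> n then obj M i else T),
     diff = (\<lambda>i. if i < n then diff M i else (\<lambda>x. \<zero>\<^bsub>T\<^esub>))\<rparr>"

text \<open>\<open>Y'\<close> agrees with \<open>Y\<close> up to degree \<open>n\<close> and is zero above, as \<open>X\<close> is; the given isomorphism is kept
  up to degree \<open>n\<close> and replaced by zero above. The terms of \<open>Y'\<close> above \<open>n\<close> are described elementwise
  and not as bimodules, since they will be tensor products.\<close>
lemma iso_C_truncated: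
  assumes X: "module_complex X" and Xn: "\<And>i. n < i \<Longrightarrow> zero_bimod (obj X i)"
    and iso: "iso_C X Y"
    and obj: "\<And>i. i \<le> n \<Longrightarrow> obj Y' i = obj Y i" and diff: "\<And>i. i < n \<Longrightarrow> diff Y' i = diff Y i"
    and car: "\<And>i. n < i \<Longrightarrow> carrier (obj Y' i) = {\<zero>\<^bsub>obj Y' i\<^esub>}"
    and add: "\<And>i. n < i \<Longrightarrow> \<zero>\<^bsub>obj Y' i\<^esub> \<oplus>\<^bsub>obj Y' i\<^esub> \<zero>\<^bsub>obj Y' i\<^esub> = \<zero>\<^bsub>obj Y' i\<^esub>"
    and la: "\<And>i l. n < i \<Longrightarrow> lact (obj Y' i) l \<zero>\<^bsub>obj Y' i\<^esub> = \<zero>\<^bsub>obj Y' i\<^esub>"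
    and ra: "\<And>i a. n < i \<Longrightarrow> ract (obj Y' i) \<zero>\<^bsub>obj Y' i\<^esub> a = \<zero>\<^bsub>obj Y' i\<^esub>"
    and diff0: "\<And>i y. \<lbrakk>n \<le> i; y \<in> carrier (obj Y' i)\<rbrakk> \<Longrightarrow> diff Y' i y = \<zero>\<^bsub>obj Y' (i + 1)\<^esub>"
  shows "iso_C X Y'"
proof -
  obtain f g where f: "f \<in> chain_map X Y" and g: "g \<in> chain_map Y X"
    and gf: "same_map X X (comp_map g f) id_map" and fg: "same_map Y Y (comp_map f g) id_map"
    using iso unfolding iso_C_def by blast
  have X0: "x = \<zero>\<^bsub>obj X i\<^esub>" if "n < i" "x \<in> carrier (obj X i)" for x i
    using Xn[OF that(1)] that(2) by (simp add: zero_bimod_def)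
  define f' where "f' i = (if i \<le> n then f i else (\<lambda>x. \<zero>\<^bsub>obj Y' i\<^esub>))" for i
  define g' where "g' i = (if i \<le> n then g i else (\<lambda>y. \<zero>\<^bsub>obj X i\<^esub>))" for i
  have f'h: "f' i \<in> mod_hom (obj X i) (obj Y' i)" for i
  proof (cases "i \<le> n")
    case True
    then show ?thesis using chain_map_hom[OF f, of i] by (simp add: f'_def obj)
  next
    case False
    then show ?thesis
      by (intro bimod_homI) (simp_all add: f'_def car add la ra)
  qed
  have g'h: "g' i \<in> mod_hom (obj Y' i) (obj X i)" for i
    using chain_map_hom[OF g, of i] bimodule.bimod_hom_into_zero[OF module_complex_bimodule[OF X]]
    by (auto simp: g'_def obj)
  have "f' (i + 1) (diff X i x) = diff Y' i (f' i x)" if x: "x \<in> carrier (obj X i)" for i x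
  proof (cases "i < n")
    case True
    then show ?thesis
      using chain_map_diff[OF f x] by (simp add: f'_def diff)
  next
    case False
    then show ?thesis
      using diff0[OF _ bimod_hom_closed[OF f'h x]] by (simp add: f'_def)
  qed
  then have f': "f' \<in> chain_map X Y'"
    using f'h by (simp add: chain_map_def)
  have "g' (i + 1) (diff Y' i y) = diff X i (g' i y)" if y: "y \<in> carrier (obj Y' i)" for i y
  proof (cases "i < n")
    case True
    then show ?thesis
      using chain_map_diff[OF g, of y i] y by (simp add: g'_def diff obj)
  next
    case False
    then show ?thesis
      using X0[OF _ diff_closed[OF X bimod_hom_closed[OF g'h y]]] by (simp add: g'_def)
  qed
  then have g': "g' \<in> chain_map Y' X"
    using g'h by (simp add: chain_map_def)
  have "same_map X X (comp_map g' f') id_map"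
    using gf X0 by (auto simp: same_map_def comp_map_def id_map_def f'_def g'_def)
  moreover have "same_map Y' Y' (comp_map f' g') id_map"
    using fg car by (auto simp: same_map_def comp_map_def id_map_def f'_def g'_def obj)
  ultimately show ?thesis
    unfolding iso_C_def using f' g' by blast
qed

lemma specialization_shift:
  "specialization h c (shift_cpx t M) = shift_cpx t (specialization h c M)"
  by (simp add: specialization_def shift_cpx_def ac_simps)

text \<open>The family \<open>M'\<close> arises from \<open>M\<close> by shifting back and truncating. The shift by \<open>- t\<close> moves \<open>M\<close> to higher
  degrees, so that it stays zero below degree \<open>1\<close>. The zero term above degree \<open>n\<close> must
  again be of the form \<open>R \<otimes>\<^sub>k P\<close> with \<open>P\<close> projective; \<open>P 0\<close> is a zero module that serves.\<close>
lemma one_param_family_window: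
  assumes M: "one_param_family scale k h M" and t: "0 \<le> t"
  shows "\<exists>M'. one_param_family scale n h M' \<and>
    (\<forall>c X. poly h c \<noteq> 0 \<and> X \<in> Cn scale n \<and> iso_C (shift_cpx t X) (specialization h c M) \<longrightarrow>
      iso_C X (specialization h c M'))"
proof -
  obtain P where h: "h \<noteq> 0" and cM: "complex_over (loc h) UNIV M"
    and P: "\<And>i. proj_mod scale (P i)" and P0: "\<And>i. i \<notin> {1..int k} \<Longrightarrow> zero_bimod (P i)"
    and oM: "\<And>i. obj M i = tensor UNIV (loc_bimod h) (P i)"
    using M unfolding one_param_family_def by blast
  note bimP = proj_mod_bimodule[OF P]
  interpret P: tensor_closed UNIV "loc_bimod h" "P i" for i
    by (rule tensor_closed_loc[OF h bimP])
  interpret Z: tensor_zero UNIV "loc_bimod h" "P 0"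
    by unfold_locales (use P0[of 0] in \<open>simp add: zero_bimod_def\<close>)
  define T where "T = tensor UNIV (loc_bimod h) (P 0)"
  have T_car: "carrier T = {\<zero>\<^bsub>T\<^esub>}" and T_add: "\<zero>\<^bsub>T\<^esub> \<oplus>\<^bsub>T\<^esub> \<zero>\<^bsub>T\<^esub> = \<zero>\<^bsub>T\<^esub>"
    and T_ract: "ract T \<zero>\<^bsub>T\<^esub> a = \<zero>\<^bsub>T\<^esub>" for a
    unfolding T_def by (rule Z.tensor_zero_carrier, rule Z.tensor_zero_add,
        rule Z.tensor_zero_ract[OF bimodule.ract_zero[OF bimP UNIV_I]])
  have T_lact: "lact T l \<zero>\<^bsub>T\<^esub> = \<zero>\<^bsub>T\<^esub>" if "l \<in> loc h" for l
    unfolding T_def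
    by (rule Z.tensor_zero_lact) (use that h in \<open>simp add: loc_bimod_def loc_mult\<close>)
  define M0 where "M0 = shift_cpx (- t) M"
  define M' where "M' = truncate_cpx (int n) T M0"
  have oM0: "obj M0 i = tensor UNIV (loc_bimod h) (P (i - t))" for i
    by (simp add: M0_def oM)
  have cM0: "complex_over (loc h) UNIV M0"
    unfolding M0_def by (rule complex_over_shift[OF cM])
  have M'_simps: "obj M' i = (if i \<le> int n then obj M0 i else T)"
      "diff M' i = (if i < int n then diff M0 i else (\<lambda>x. \<zero>\<^bsub>T\<^esub>))" for i
    by (simp_all add: M'_def truncate_cpx_def)
  have "complex_over (loc h) UNIV M'"
    unfolding complex_over_def
  proof (intro conjI allI ballI)
    fix i
    show "diff M' i \<in> bimod_hom (loc h) UNIV (obj M' i) (obj M' (i + 1))"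
    proof (cases "i < int n")
      case True
      then show ?thesis
        using cM0 by (simp add: M'_simps complex_over_def)
    next
      case False
      then show ?thesis
        by (intro bimod_homI) (simp_all add: M'_simps T_car T_add T_lact T_ract)
    qed
    fix x assume x: "x \<in> carrier (obj M' i)"
    show "diff M' (i + 1) (diff M' i x) = \<zero>\<^bsub>obj M' (i + 1 + 1)\<^esub>"
    proof (cases "i + 1 < int n")
      case True
      then have "x \<in> carrier (obj M0 i)"
        using x by (simp add: M'_simps)
      then have "diff M0 (i + 1) (diff M0 i x) = \<zero>\<^bsub>obj M0 (i + 1 + 1)\<^esub>"
        using cM0 unfolding complex_over_def by blast
      then show ?thesis
        using True by (simp add: M'_simps)
    next
      case False
      then show ?thesis
        by (simp add: M'_simps)
    qed
  qed
  moreover have "obj M' i = tensor UNIV (loc_bimod h) (if i \<le> int n then P (i - t) else P 0)" for i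
    by (simp add: M'_simps oM0 T_def)
  moreover have "zero_bimod (if i \<le> int n then P (i - t) else P 0)" if "i \<notin> {1..int n}" for i
    using that P0 t by auto
  ultimately have fam: "one_param_family scale n h M'"
    unfolding one_param_family_def
    using h P by (intro conjI exI[of _ "\<lambda>i. if i \<le> int n then P (i - t) else P 0"]) auto
  have "iso_C X (specialization h c M')"
    if hc: "poly h c \<noteq> 0" and X: "X \<in> Cn scale n"
      and iso: "iso_C (shift_cpx t X) (specialization h c M)" for c X
  proof (rule iso_C_truncated)
    have spec_obj: "obj (specialization h c K) i = tensor (loc h) (residue_bimod h c) (obj K i)"
      and spec_diff: "diff (specialization h c K) i = tensor_map (loc h) (residue_bimod h c)
        (obj K (i + 1)) (\<lambda>(f, y). (f, diff K i y))" for K :: "('a, 'b) family" and i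
      by (simp_all add: specialization_def)
    show "module_complex X" "\<And>i. int n < i \<Longrightarrow> zero_bimod (obj X i)"
      using X by (auto simp: Cn_iff intro: Cb_module_complex)
    show "iso_C X (specialization h c M0)"
      unfolding M0_def specialization_shift by (rule iso_C_unshift[OF iso])
    show "obj (specialization h c M') i = obj (specialization h c M0) i" if "i \<le> int n" for i
      using that by (simp add: spec_obj M'_simps)
    show "diff (specialization h c M') i = diff (specialization h c M0) i" if "i < int n" for i
      using that by (simp add: spec_diff M'_simps)
    interpret R: tensor_zero "loc h" "residue_bimod h c" T
      unfolding tensor_zero_def tensor_zero_axioms_def
      by (intro conjI tensor_closed_residue[OF hc]) (auto simp: T_car T_add T_lact)
    fix i
    {
      assume i: "int n < i"
      then have oi: "obj (specialization h c M') i = tensor (loc h) (residue_bimod h c) T"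
        by (simp add: spec_obj M'_simps)
      show "carrier (obj (specialization h c M') i) = {\<zero>\<^bsub>obj (specialization h c M') i\<^esub>}"
        unfolding oi by (rule R.tensor_zero_carrier)
      show "\<zero>\<^bsub>obj (specialization h c M') i\<^esub> \<oplus>\<^bsub>obj (specialization h c M') i\<^esub>
          \<zero>\<^bsub>obj (specialization h c M') i\<^esub> = \<zero>\<^bsub>obj (specialization h c M') i\<^esub>"
        unfolding oi by (rule R.tensor_zero_add)
      show "lact (obj (specialization h c M') i) l \<zero>\<^bsub>obj (specialization h c M') i\<^esub> =
          \<zero>\<^bsub>obj (specialization h c M') i\<^esub>" for l
        unfolding oi by (rule R.tensor_zero_lact) (rule residue_lact)
      show "ract (obj (specialization h c M') i) \<zero>\<^bsub>obj (specialization h c M') i\<^esub> a =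
          \<zero>\<^bsub>obj (specialization h c M') i\<^esub>" for a
        unfolding oi by (rule R.tensor_zero_ract) (rule T_ract)
    }
    fix C assume i: "int n \<le> i" and C: "C \<in> carrier (obj (specialization h c M') i)"
    interpret i: tensor_closed "loc h" "residue_bimod h c" "obj M' i"
    proof (rule tensor_closed_residue[OF hc])
      show "y \<oplus>\<^bsub>obj M' i\<^esub> y' \<in> carrier (obj M' i)"
        if "y \<in> carrier (obj M' i)" "y' \<in> carrier (obj M' i)" for y y'
        using that P.tensor_add_closed[of y "i - t" y'] by (auto simp: M'_simps oM0 T_car T_add)
      show "lact (obj M' i) r y \<in> carrier (obj M' i)"
        if r: "r \<in> loc h" and y: "y \<in> carrier (obj M' i)" for r y
      proof (cases "i \<le> int n")
        case True
        have "lact (tensor UNIV (loc_bimod h) (P (i - t))) r y \<in> carrier (tensor UNIV (loc_bimod h) (P (i - t)))"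
          by (rule P.tensor_lact_closed)
            (use r y True h in \<open>simp_all add: loc_bimod_def loc_mult algebra_simps M'_simps oM0\<close>)
        then show ?thesis
          using True by (simp add: M'_simps oM0)
      next
        case False
        then show ?thesis
          using r y by (simp add: M'_simps T_car T_lact)
      qed
    qed
    \<comment> \<open>The differential out of the last term sends \<open>f \<otimes> y\<close> to \<open>f \<otimes> 0\<close>, so it remains to see that \<open>C\<close>
        consists of formal sums of pairs \<open>(f, y)\<close> with \<open>f\<close> in the residue module.\<close>
    have C: "C \<noteq> {}" "C \<subseteq> carrier (pair_sums (residue_bimod h c) (obj M' i))"
      using i.tensor_elem[of C] C by (simp_all add: spec_obj)
    have "tensor_map (loc h) (residue_bimod h c) T (\<lambda>(f, y). (f, \<zero>\<^bsub>T\<^esub>)) C =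
        \<zero>\<^bsub>tensor (loc h) (residue_bimod h c) T\<^esub>"
      by (rule R.tensor_map_into_zero[OF R.tensor_null_eq C(1)]) (use C(2) T_car in fastforce)
    then show "diff (specialization h c M') i C = \<zero>\<^bsub>obj (specialization h c M') (i + 1)\<^esub>"
      using i by (simp add: spec_diff spec_obj M'_simps)
  qed
  then show ?thesis
    using fam by blast
qed

section \<open>Tameness\<close>

text \<open>The lowest degree \<open>r\<close> of \<open>X\<close> lies between \<open>1\<close> and \<open>n\<close>, and shifting it to degree \<open>1\<close> moves the
  support into \<open>{1..\<eta> + 1}\<close>. It matters that the number of possible shifts does not depend
  on \<open>X\<close>.\<close>
lemma indecomposable_shift_into_window:
  assumes fd: "fd_algebra scale" and dim: "s_gl_dim scale \<le> enat \<eta>" and \<eta>: "\<eta> \<ge> 1"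
    and ind: "indecomposable same_map (Cn scale n) X"
  obtains t where "t < n" "indecomposable same_map (Cn scale (\<eta> + 1)) (shift_cpx (int t) X)"
proof -
  have X: "X \<in> Cn scale n"
    using ind by (simp add: indecomposable_def)
  have indb: "indecomposable same_map (Cb scale) X"
    using ind indecomposable_Cn_iff[OF X] by blast
  obtain r where r: "\<not> zero_bimod (obj X r)"
    and supp: "\<And>i. i < r \<or> r + int \<eta> < i \<Longrightarrow> zero_bimod (obj X i)"
    using indecomposable_support[OF fd dim \<eta> indb] by blast
  have rn: "r \<in> {1..int n}"
    using r X by (auto simp: Cn_iff)
  define t where "t = nat (r - 1)"
  have t: "int t = r - 1" "t < n"
    using rn by (auto simp: t_def)
  have "zero_bimod (obj (shift_cpx (int t) X) i)" if "i \<notin> {1..int (\<eta> + 1)}" for i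
    using that supp[of "i + int t"] t(1) by auto
  then have "shift_cpx (int t) X \<in> Cn scale (\<eta> + 1)"
    using X Cb_shift[of X scale "int t"] unfolding Cn_iff by blast
  then show thesis
    using that[OF t(2)] indecomposable_Cn_iff indecomposable_shift[OF indb] by blast
qed

text \<open>Tameness for a single vector \<open>m\<close> of dimensions, with the exceptional complexes \<open>\<E>\<close> and the
  families \<open>\<F>\<close> as parameters, so that both can be transported along shifts.\<close>
definition parametrizes ::
  "('k::field \<Rightarrow> 'a::ring_1 \<Rightarrow> 'a) \<Rightarrow> nat \<Rightarrow> (int \<Rightarrow> nat) \<Rightarrow>
    ('k, 'a, nat \<Rightarrow> 'a) cpx set \<Rightarrow> ('k poly \<times> ('k, 'a) family) set \<Rightarrow> bool" where
  "parametrizes scale n m \<E> \<F> \<longleftrightarrow> finite \<E> \<and> \<E> \<subseteq> Cn scale n \<and>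
     finite \<F> \<and> (\<forall>(h, M)\<in>\<F>. one_param_family scale n h M) \<and>
     (\<forall>X. indecomposable same_map (Cn scale n) X \<and> (\<forall>i\<in>{1..int n}. has_dim (obj X i) (m i)) \<longrightarrow>
        (\<exists>Y\<in>\<E>. iso_C X Y) \<or>
        (\<exists>(h, M)\<in>\<F>. \<exists>c. poly h c \<noteq> 0 \<and> iso_C X (specialization h c M)))"

lemma tame_iff: "tame scale n \<longleftrightarrow> (\<forall>m. \<exists>\<E> \<F>. parametrizes scale n m \<E> \<F>)"
  unfolding tame_def parametrizes_def ..

text \<open>The representatives for \<open>C\<^sub>n\<close> are collected from all windows \<open>{t + 1..t + \<eta> + 1}\<close> with \<open>t < n\<close>.\<close>
lemma tame_from_window:
  assumes fd: "fd_algebra scale" and dim: "s_gl_dim scale \<le> enat \<eta>" and \<eta>: "\<eta> \<ge> 1"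
    and tame: "tame scale (\<eta> + 1)"
  shows "tame scale n"
  unfolding tame_iff
proof
  fix m :: "int \<Rightarrow> nat"
  \<comment> \<open>The dimensions of a shift by \<open>t\<close>. Positions outside \<open>{1..n}\<close> get dimension \<open>0\<close>, since the objects of
      \<open>C\<^sub>n\<close> vanish there.\<close>
  define m' where "m' t i = (if i + int t \<in> {1..int n} then m (i + int t) else 0)" for t i
  have "\<exists>EF. parametrizes scale (\<eta> + 1) (m' t) (fst EF) (snd EF)" for t
    using tame unfolding tame_iff by (metis fst_conv snd_conv)
  then have "\<forall>t. \<exists>EF. parametrizes scale (\<eta> + 1) (m' t) (fst EF) (snd EF)"
    by blast
  from choice[OF this] obtain EF
    where EF: "\<And>t. parametrizes scale (\<eta> + 1) (m' t) (fst (EF t)) (snd (EF t))"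
    by blast
  define fits where "fits t h M M' \<longleftrightarrow> one_param_family scale n h M' \<and>
      (\<forall>c X. poly h c \<noteq> 0 \<and> X \<in> Cn scale n \<and> iso_C (shift_cpx (int t) X) (specialization h c M) \<longrightarrow>
        iso_C X (specialization h c M'))" for t h M M'
  define W where "W t h M = (SOME M'. fits t h M M')" for t h M
  have W: "fits t h M (W t h M)" if "one_param_family scale (\<eta> + 1) h M" for t h M
    unfolding W_def using one_param_family_window[OF that, of "int t" n]
    by (intro someI_ex[of "fits t h M"]) (simp add: fits_def)
  \<comment> \<open>Some of the exceptional complexes may leave \<open>C\<^sub>n\<close> when shifted back; these are not isomorphic to
      any \<open>X\<close> in \<open>C\<^sub>n\<close> and can be dropped.\<close>
  define \<E> where "\<E> = (\<Union>t<n. shift_cpx (- int t) ` fst (EF t)) \<inter> Cn scale n"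
  define \<F> where "\<F> = (\<Union>t<n. (\<lambda>(h, M). (h, W t h M)) ` snd (EF t))"
  have "finite \<E>" "finite \<F>"
    using EF unfolding \<E>_def \<F>_def parametrizes_def by auto
  moreover have "\<E> \<subseteq> Cn scale n"
    by (simp add: \<E>_def)
  moreover have fam: "one_param_family scale (\<eta> + 1) h M" if "(h, M) \<in> snd (EF t)" for t h M
    using EF[of t] that unfolding parametrizes_def by blast
  then have "\<forall>(h, M)\<in>\<F>. one_param_family scale n h M"
    using W by (auto simp: \<F>_def fits_def)
  moreover have "(\<exists>Y\<in>\<E>. iso_C X Y) \<or>
      (\<exists>(h, M)\<in>\<F>. \<exists>c. poly h c \<noteq> 0 \<and> iso_C X (specialization h c M))"
    if ind: "indecomposable same_map (Cn scale n) X"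
      and dims: "\<forall>i\<in>{1..int n}. has_dim (obj X i) (m i)" for X
  proof -
    have X: "X \<in> Cn scale n"
      using ind by (simp add: indecomposable_def)
    then have Xb: "X \<in> Cb scale" and zero: "\<And>i. i \<notin> {1..int n} \<Longrightarrow> zero_bimod (obj X i)"
      by (auto simp: Cn_iff)
    note mX = Cb_module_complex[OF Xb]
    obtain t where t: "t < n" "indecomposable same_map (Cn scale (\<eta> + 1)) (shift_cpx (int t) X)"
      using indecomposable_shift_into_window[OF fd dim \<eta> ind] by blast
    have "has_dim (obj (shift_cpx (int t) X) i) (m' t i)" for i
      using dims has_dim_zero[OF module_complex_bimodule[OF mX] zero] by (simp add: m'_def)
    then consider Y where "Y \<in> fst (EF t)" "iso_C (shift_cpx (int t) X) Y"
      | h M c where "(h, M) \<in> snd (EF t)" "poly h c \<noteq> 0"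
          "iso_C (shift_cpx (int t) X) (specialization h c M)"
      using EF[of t] t(2) unfolding parametrizes_def by blast
    then show ?thesis
    proof cases
      case 1
      let ?Z = "shift_cpx (- int t) Y"
      have iso: "iso_C X ?Z"
        by (rule iso_C_unshift[OF 1(2)])
      have "Y \<in> Cb scale"
        using EF[of t] 1(1) unfolding parametrizes_def by (auto simp: Cn_iff)
      then have Z: "?Z \<in> Cb scale"
        by (rule Cb_shift)
      obtain f g where "f \<in> chain_map X ?Z" "g \<in> chain_map ?Z X" "same_map ?Z ?Z (comp_map f g) id_map"
        using iso unfolding iso_C_def by blast
      then have "zero_bimod (obj ?Z i)" if "i \<notin> {1..int n}" for i
        using retract_zero[OF mX Cb_module_complex[OF Z] _ _ _ zero[OF that]] by blast
      then have "?Z \<in> Cn scale n"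
        using Z unfolding Cn_iff by blast
      then have "?Z \<in> \<E>"
        using 1(1) t(1) by (auto simp: \<E>_def)
      then show ?thesis
        using iso by blast
    next
      case 2
      have "iso_C X (specialization h c (W t h M))"
        using W[OF fam[OF 2(1)]] 2(2,3) X unfolding fits_def by blast
      moreover have "(h, W t h M) \<in> \<F>"
        using 2(1) t(1) by (force simp: \<F>_def)
      ultimately show ?thesis
        using 2(2) by blast
    qed
  qed
  ultimately have "parametrizes scale n m \<E> \<F>"
    unfolding parametrizes_def by blast
  then show "\<exists>\<E> \<F>. parametrizes scale n m \<E> \<F>"
    by blast
qed

theorem theorem4p4:
  fixes scale :: "'k::alg_closed_field \<Rightarrow> 'a::ring_1 \<Rightarrow> 'a" and \<eta> :: nat
  assumes "fd_algebra scale"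
    and "s_gl_dim scale = enat \<eta>"
    and "\<eta> \<ge> 1"
  shows "tame scale (\<eta> + 1) \<longleftrightarrow> (\<forall>n\<ge>1. tame scale n)"
proof
  assume "tame scale (\<eta> + 1)"
  then show "\<forall>n\<ge>1. tame scale n"
    using tame_from_window[OF assms(1) _ assms(3)] assms(2) by simp
next
  assume "\<forall>n\<ge>1. tame scale n"
  then show "tame scale (\<eta> + 1)"
    by simp
qed

end
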